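(* Let $J_T$ be an arbitrary period-$T$ Jacobi operator, let $n\in\mathbb{N}$, and let $\{\lambda_i\}_{i=n+1}^\infty$ be a sequence of numbers belonging to $\sigma_{ell}(J_T)$ such that every collection $\{\pi,\theta(\lambda_{n+1}),\theta(\lambda_{n+2}),\dots,\theta(\lambda_{n+k})\}$, $k\ge 1$, is rationally independent. Let $\{\lambda_1,\dots,\lambda_n\}\subseteq\sigma_{ell}(J_T)$ be such that $$\theta(\lambda_1)=\frac{p_1\pi}{q_1},\ \theta(\lambda_2)=\frac{p_2\pi}{q_2},\ \dots,\ \theta(\lambda_n)=\frac{p_n\pi}{q_n},$$ where $p_i,q_i\in\mathbb{N}$, $\gcd(p_i,q_i)=1$, $\gcd(q_i,q_j)=1$ for all $i\neq j$, and $\theta(\lambda_i)\neq\frac{\pi}{2}$ for all $i\in\{1,\dots,n\}$. Then for any positive sequence $K(m)$ with $K(m)\to\infty$ (arbitrarily slowly) as $m\to\infty$, there exist a real sequence (potential) $(\mathsf{q}_m)_{m\ge1}$ with $|\mathsf{q}_m|\leq\frac{K(m)}{m}$ for all $m$, and, for every $i\geq 1$, a non-zero vector $(u_{m,i})_{m\geq 1}\in l^2(\mathbb{N};\mathbb{R})$, such that $$(J_T+Q)(u_{m,i})_{m\geq 1}=\lambda_i(u_{m,i})_{m\geq 1}\quad\text{for all } i\ge 1,$$ where $Q$ is the infinite diagonal matrix with entries $(\mathsf{q}_m)$.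
   Context: A period-$T$ Jacobi operator $J_T$ ($T\in\mathbb{N}$) is the operator on $l^2(\mathbb{N})$ given by the tridiagonal symmetric matrix with diagonal entries $b_1,b_2,\dots$ and off-diagonal entries $a_1,a_2,\dots$, where $(a_n)$ and $(b_n)$ are $T$-periodic, $a_n,b_n\in\mathbb{R}$ and $a_n>0$; that is, $(J_Tu)_1=b_1u_1+a_1u_2$ and $(J_Tu)_n=a_{n-1}u_{n-1}+b_nu_n+a_nu_{n+1}$ for $n\ge 2$. The transfer matrices are $$B_i(\lambda)=\begin{pmatrix}0&1\\-\frac{a_{i-1}}{a_i}&\frac{\lambda-b_i}{a_i}\end{pmatrix},\quad i\in\{1,\dots,T\},\ a_0:=a_T,$$ and the monodromy matrix is $M(\lambda)=B_T(\lambda)\cdots B_1(\lambda)$. The generalised interior of the essential spectrum is $\sigma_{ell}(J_T)=\{\lambda\in\mathbb{R} : |\operatorname{Tr}M(\lambda)|<2\}$. For $\lambda\in\sigma_{ell}(J_T)$ the eigenvalues of $M(\lambda)$ are $e^{\pm i\theta(\lambda)}$ with $\theta(\lambda)\in(0,\pi)$; $\theta(\lambda)$ is called the quasi-momentum. A finite collection of real numbers is rationally independent if it is linearly independent over $\mathbb{Q}$. The integers $q_i$ (denominators) and the potential entries $\mathsf{q}_m$ are unrelated. *)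

theory Defs
  imports "HOL-Analysis.Analysis"
begin

text \<open>
  Sequences over the positive integers are functions on \<^typ>\<open>nat\<close> of which only the values at
  indices \<open>\<ge> 1\<close> are used; the value at \<open>0\<close> is never read.
\<close>

definition periodic_jacobi :: "nat \<Rightarrow> (nat \<Rightarrow> real) \<Rightarrow> (nat \<Rightarrow> real) \<Rightarrow> bool" where
  "periodic_jacobi T a b \<longleftrightarrow>
     T \<ge> 1 \<and> (\<forall>n\<ge>1. a n > 0 \<and> a (n + T) = a n \<and> b (n + T) = b n)"

definition l2_seq :: "(nat \<Rightarrow> real) set" where
  "l2_seq = {u. summable (\<lambda>m. (u (Suc m))\<^sup>2)}"

definition jacobi_op :: "(nat \<Rightarrow> real) \<Rightarrow> (nat \<Rightarrow> real) \<Rightarrow> (nat \<Rightarrow> real) \<Rightarrow> nat \<Rightarrow> real" where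
  "jacobi_op a b u n =
     (if n = 1 then b 1 * u 1 + a 1 * u 2
      else a (n - 1) * u (n - 1) + b n * u n + a n * u (n + 1))"

definition diag_op :: "(nat \<Rightarrow> real) \<Rightarrow> (nat \<Rightarrow> real) \<Rightarrow> nat \<Rightarrow> real" where
  "diag_op q u n = q n * u n"

text \<open>The \<open>if\<close> implements the convention \<open>a\<^sub>0 := a\<^sub>T\<close>.\<close>

definition transfer_matrix ::
    "nat \<Rightarrow> (nat \<Rightarrow> real) \<Rightarrow> (nat \<Rightarrow> real) \<Rightarrow> nat \<Rightarrow> real \<Rightarrow> real^2^2" where
  "transfer_matrix T a b i x =
     vector [vector [0, 1],
             vector [- ((if i = 1 then a T else a (i - 1)) / a i), (x - b i) / a i]]"

fun transfer_product ::
    "nat \<Rightarrow> (nat \<Rightarrow> real) \<Rightarrow> (nat \<Rightarrow> real) \<Rightarrow> nat \<Rightarrow> real \<Rightarrow> real^2^2" where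
  "transfer_product T a b 0 x = mat 1"
| "transfer_product T a b (Suc k) x =
     transfer_matrix T a b (Suc k) x ** transfer_product T a b k x"

definition monodromy :: "nat \<Rightarrow> (nat \<Rightarrow> real) \<Rightarrow> (nat \<Rightarrow> real) \<Rightarrow> real \<Rightarrow> real^2^2" where
  "monodromy T a b x = transfer_product T a b T x"

definition sigma_ell :: "nat \<Rightarrow> (nat \<Rightarrow> real) \<Rightarrow> (nat \<Rightarrow> real) \<Rightarrow> real set" where
  "sigma_ell T a b = {x. \<bar>trace (monodromy T a b x)\<bar> < 2}"

definition complex_eigenvalues :: "real^'n^'n \<Rightarrow> complex set" where
  "complex_eigenvalues A =
     {z. \<exists>v::complex^'n. v \<noteq> 0 \<and> map_matrix complex_of_real A *v v = z *s v}"

text \<open>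
  The definite description is justified, for points of \<^const>\<open>sigma_ell\<close>, by the lemma
  \<open>quasi_momentum_eq_iff\<close> below.
\<close>

definition quasi_momentum ::
    "nat \<Rightarrow> (nat \<Rightarrow> real) \<Rightarrow> (nat \<Rightarrow> real) \<Rightarrow> real \<Rightarrow> real" where
  "quasi_momentum T a b x =
     (THE t. 0 < t \<and> t < pi \<and>
             complex_eigenvalues (monodromy T a b x) = {cis t, cis (- t)})"

text \<open>
  Independence of a collection, i.e. of a family: a repeated entry makes it dependent, which is
  why distinctness accompanies the set-based library notion.
\<close>

definition rationally_independent :: "real list \<Rightarrow> bool" where
  "rationally_independent xs \<longleftrightarrow>
     distinct xs \<and> module.independent (\<lambda>r::rat. (*) (of_rat r :: real)) (set xs)"

lemma complex_eigenvalues_2: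
  fixes A :: "real^2^2"
  shows "complex_eigenvalues A = {z. z\<^sup>2 - of_real (trace A) * z + of_real (det A) = 0}"
proof -
  have "(\<exists>v::complex^2. v \<noteq> 0 \<and> map_matrix complex_of_real A *v v = z *s v) \<longleftrightarrow>
        z\<^sup>2 - of_real (trace A) * z + of_real (det A) = 0" (is "?L \<longleftrightarrow> ?R") for z
  proof -
    define B where "B = map_matrix complex_of_real A - mat z"
    have eq: "map_matrix complex_of_real A *v v = z *s v \<longleftrightarrow> B *v v = 0" for v
      by (auto simp: B_def vec_eq_iff matrix_vector_mult_def mat_def sum_2 forall_2 algebra_simps)
    have "?L \<longleftrightarrow> \<not> (\<forall>v. B *v v = 0 \<longrightarrow> v = 0)"
      unfolding eq by blast
    also have "\<dots> \<longleftrightarrow> det B = 0"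
      using invertible_det_nz[of B] matrix_left_invertible_ker[of B] invertible_left_inverse[of B]
      by metis
    also have "det B = z\<^sup>2 - of_real (trace A) * z + of_real (det A)"
      by (simp add: B_def det_2 trace_def sum_2 mat_def algebra_simps power2_eq_square)
    finally show ?thesis .
  qed
  then show ?thesis by (simp add: complex_eigenvalues_def)
qed

lemma det_monodromy:
  assumes "periodic_jacobi T a b"
  shows "det (monodromy T a b x) = 1"
proof -
  have pos: "a n > 0" if "n \<ge> 1" for n
    using assms that by (auto simp: periodic_jacobi_def)
  have T: "T \<ge> 1" using assms by (simp add: periodic_jacobi_def)
  have "det (transfer_product T a b k x) = (if k = 0 then 1 else a T / a k)" for k
  proof (induction k)
    case 0 then show ?case by simp
  next
    case (Suc k)
    have "det (transfer_matrix T a b (Suc k) x) = (if k = 0 then a T else a k) / a (Suc k)"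
      by (simp add: transfer_matrix_def det_2)
    then have "det (transfer_product T a b (Suc k) x) =
        (if k = 0 then a T else a k) / a (Suc k) * det (transfer_product T a b k x)"
      by (simp only: transfer_product.simps det_mul)
    then show ?case
      using pos[of k] Suc.IH by (cases "k = 0") simp_all
  qed
  then show ?thesis using pos[of T] T by (simp add: monodromy_def)
qed

lemma quasi_momentum_eq_iff:
  assumes J: "periodic_jacobi T a b" and x: "x \<in> sigma_ell T a b"
  shows "quasi_momentum T a b x = t \<longleftrightarrow>
    0 < t \<and> t < pi \<and> complex_eigenvalues (monodromy T a b x) = {cis t, cis (- t)}"
proof -
  let ?E = "complex_eigenvalues (monodromy T a b x)"
  let ?P = "\<lambda>t. 0 < t \<and> t < pi \<and> ?E = {cis t, cis (- t)}"
  define c where "c = trace (monodromy T a b x) / 2"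
  have c: "\<bar>c\<bar> < 1" using x by (simp add: sigma_ell_def c_def)
  define s where "s = arccos c"
  have s: "0 < s" "s < pi" "cos s = c"
    using c arccos_lt_bounded[of c] by (auto simp: s_def)
  have "z\<^sup>2 - of_real (2 * c) * z + 1 = (z - cis s) * (z - cis (- s))" for z
  proof -
    have "cis s + cis (- s) = of_real (2 * c)"
      by (simp add: complex_eq_iff s)
    moreover have "cis s * cis (- s) = 1" by (simp add: cis_mult)
    ultimately show ?thesis by (simp add: power2_eq_square algebra_simps flip: distrib_left)
  qed
  then have E: "?E = {cis s, cis (- s)}"
    by (auto simp: complex_eigenvalues_2 det_monodromy[OF J] c_def)
  then have ex: "?P s" using s by simp
  have uniq: "t' = s" if "?P t'" for t'
  proof -
    have t': "0 < t'" "t' < pi" "{cis t', cis (- t')} = {cis s, cis (- s)}"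
      using that E by auto
    then have "cis t' = cis s \<or> cis t' = cis (- s)" by blast
    then have "cos t' = cos s" by (auto simp: complex_eq_iff)
    then show ?thesis using t' s cos_inj_pi[of t' s] by simp
  qed
  then have "quasi_momentum T a b x = s"
    unfolding quasi_momentum_def using ex by (intro the_equality) auto
  then show ?thesis using ex uniq by blast
qed

end

theory Submission
  imports Defs "HOL-Real_Asymp.Real_Asymp"
begin

text \<open>
  Write \<open>\<theta> i\<close> for the quasi-momentum of the \<open>i\<close>-th prescribed number.  The solution \<open>u\<close> of the
  eigenvalue equation that satisfies the boundary condition always exists and never
  vanishes identically; the potential only has to make it square-summable, for all \<open>i\<close> at once.  The
  potential is placed at the last site of each period.  The monodromy matrix is similar to the
  rotation by \<open>\<theta> i\<close>; in a suitable complex coordinate \<open>w\<close>, passing one period is this rotation followed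
  by a shear \<open>w \<mapsto> w - (\<epsilon> / s) Im w\<close>, where \<open>\<epsilon>\<close> is proportional to the potential
  (\<open>monodromy_rotation\<close>, \<open>eigvec_eq_shear_orbit\<close>).  So the relative change of the squared length of \<open>w\<close> is
  \<open>- (\<epsilon> / s) sin (2 arg w)\<close> up to second order.

  The potential is defined by feedback: after \<open>k\<close> periods \<open>\<epsilon>\<close> is the sum of
  \<open>4 s / (k + 1) sin (2 arg w)\<close> over the finitely many eigenvalues that are active by then.  The summand
  of an eigenvalue acts on its own solution through a squared sine with mean \<open>1 / 2\<close>, and forces
  the length to decay like \<open>1 / k\<close>.  Its action on another solution is a product of two
  sines, that is, an oscillation with frequencies \<open>2 (\<theta> i + \<theta> j)\<close> and \<open>2 (\<theta> i - \<theta> j)\<close>; since the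
  weights \<open>1 / (k + 1)\<close> are monotone, summation by parts (\<open>oscillating_sum_bound\<close>) bounds the total effect,
  and makes it as small as desired if the summand is switched on late.  Hence new eigenvalues can
  be switched on one after the other, slowly enough for the budget \<open>K m / m\<close> and for a finite
  total disturbance of each solution (\<open>decaying_control\<close>).

  The argument needs that \<open>2 (\<theta> i + \<theta> j)\<close> and \<open>2 (\<theta> i - \<theta> j)\<close> for \<open>i \<noteq> j\<close>, as well as \<open>4 \<theta> i\<close>, are no
  multiples of \<open>2 \<pi>\<close>; \<open>nonresonant_angles\<close> derives this from the arithmetic hypotheses.
\<close>

section \<open>Sums along an almost uniform rotation\<close>

text \<open>
  Abel summation.  If \<open>Z (k + 1)\<close> is \<open>\<omega> Z k\<close> up to a small error and \<open>\<omega> \<noteq> 1\<close>, then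
  \<open>(\<omega> - 1) Z k\<close> is the difference \<open>Z (k + 1) - Z k\<close> up to that error, so that a sum with decreasing
  weights telescopes.  The bound does not depend on \<open>n\<close> and tends to 0 as \<open>m\<close> grows.
\<close>

lemma oscillating_sum_bound:
  fixes Z :: "nat \<Rightarrow> complex" and c e :: "nat \<Rightarrow> real"
  assumes "\<omega> \<noteq> 1" and Z: "\<And>k. norm (Z k) \<le> 1"
    and rot: "\<And>k. norm (Z (Suc k) - \<omega> * Z k) \<le> C * e k"
    and "decseq c" and c: "\<And>k. 0 \<le> c k" "\<And>k. c k \<le> e k"
    and e: "summable (\<lambda>k. (e k)\<^sup>2)" and "0 \<le> C"
  shows "norm (\<Sum>k=m..<n. of_real (c k) * Z k)
           \<le> (2 * c m + C * (\<Sum>k. (e (k + m))\<^sup>2)) / norm (\<omega> - 1)"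
proof -
  have e0: "0 \<le> e k" for k using c[of k] by linarith
  have dec: "c (Suc k) \<le> c k" for k using \<open>decseq c\<close> by (simp add: decseq_Suc_iff)
  have e': "summable (\<lambda>k. (e (k + m))\<^sup>2)" using e by (rule summable_ignore_initial_segment)
  have sume0: "0 \<le> (\<Sum>k. (e (k + m))\<^sup>2)" by (rule suminf_nonneg[OF e']) simp
  show ?thesis
  proof (cases "m \<le> n")
    case False
    then show ?thesis using c(1)[of m] \<open>0 \<le> C\<close> sume0 by simp
  next
    case True
    define S where "S n = (\<Sum>k=m..<n. of_real (c k) * (Z (Suc k) - Z k))" for n
    have "norm (S n - of_real (c n) * Z n) \<le> 2 * c m - c n"
      using True
    proof (induction n rule: dec_induct)
      case base
      have "c m * norm (Z m) \<le> c m * 1" by (intro mult_left_mono Z c)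
      then show ?case using c(1)[of m] by (simp add: S_def norm_mult)
    next
      case (step n)
      have "S (Suc n) - of_real (c (Suc n)) * Z (Suc n)
          = (S n - of_real (c n) * Z n) + of_real (c n - c (Suc n)) * Z (Suc n)"
        using step.hyps by (simp add: S_def algebra_simps)
      also have "norm \<dots> \<le> (2 * c m - c n) + (c n - c (Suc n))"
      proof (rule norm_triangle_mono[OF step.IH])
        have "(c n - c (Suc n)) * norm (Z (Suc n)) \<le> (c n - c (Suc n)) * 1"
          using dec[of n] by (intro mult_left_mono Z) simp
        then show "norm (of_real (c n - c (Suc n)) * Z (Suc n)) \<le> c n - c (Suc n)"
          using dec[of n] by (simp add: norm_mult flip: of_real_diff)
      qed
      finally show ?case by simp
    qed
    moreover have "norm (of_real (c n) * Z n) \<le> c n"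
      using mult_left_mono[OF Z[of n] c(1)[of n]] c(1)[of n] by (simp add: norm_mult)
    ultimately have S: "norm (S n) \<le> 2 * c m"
      using norm_triangle_sub[of "S n" "of_real (c n) * Z n"] by linarith
    define R where "R = (\<Sum>k=m..<n. of_real (c k) * (Z (Suc k) - \<omega> * Z k))"
    have "norm R \<le> (\<Sum>k=m..<n. C * (e k)\<^sup>2)"
      unfolding R_def
    proof (rule sum_norm_le)
      fix k
      have "c k * norm (Z (Suc k) - \<omega> * Z k) \<le> e k * (C * e k)"
        by (intro mult_mono c rot e0) simp
      then show "norm (of_real (c k) * (Z (Suc k) - \<omega> * Z k)) \<le> C * (e k)\<^sup>2"
        using c(1)[of k] by (simp add: norm_mult power2_eq_square mult.left_commute)
    qed
    also have "\<dots> = C * (\<Sum>k<n-m. (e (k + m))\<^sup>2)"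
      using True by (simp add: sum_distrib_left sum.atLeastLessThan_shift_0 atLeast0LessThan add.commute)
    also have "\<dots> \<le> C * (\<Sum>k. (e (k + m))\<^sup>2)"
      by (intro mult_left_mono sum_le_suminf e' \<open>0 \<le> C\<close>) auto
    finally have R: "norm R \<le> C * (\<Sum>k. (e (k + m))\<^sup>2)" .
    have "(\<omega> - 1) * (\<Sum>k=m..<n. of_real (c k) * Z k) = S n - R"
      unfolding S_def R_def sum_distrib_left sum_subtractf[symmetric]
      by (rule sum.cong) (simp_all add: algebra_simps)
    then have "norm (\<omega> - 1) * norm (\<Sum>k=m..<n. of_real (c k) * Z k) = norm (S n - R)"
      by (metis norm_mult)
    also have "\<dots> \<le> 2 * c m + C * (\<Sum>k. (e (k + m))\<^sup>2)"
      using S R norm_triangle_ineq4[of "S n" R] by linarith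
    finally show ?thesis
      using \<open>\<omega> \<noteq> 1\<close> by (simp add: pos_le_divide_eq mult.commute)
  qed
qed

section \<open>Shears of the complex plane\<close>

text \<open>
  In the coordinate in which the monodromy matrix is a rotation, the potential at one site acts as
  a shear parallel to the real axis.
\<close>

definition shear :: "real \<Rightarrow> complex \<Rightarrow> complex" where
  "shear t v = v - of_real (t * Im v)"

lemma shear_eq_0_iff [simp]: "shear t v = 0 \<longleftrightarrow> v = 0"
  by (auto simp: shear_def complex_eq_iff)

text \<open>
  To first order in \<open>t\<close> the shear changes the length of \<open>v\<close> according to the sine of twice the
  argument of \<open>v\<close>, which takes both signs: whether a shear contracts depends on the direction.
\<close>

lemma norm_shear_le:
  "(norm (shear t v))\<^sup>2 \<le> (norm v)\<^sup>2 * exp (t\<^sup>2 - t * Im ((sgn v)\<^sup>2))"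
proof (cases "v = 0")
  case False
  define x where "x = sgn v"
  have v: "Re v = norm v * Re x" "Im v = norm v * Im x"
    using False by (simp_all add: x_def sgn_eq)
  have x: "(Re x)\<^sup>2 + (Im x)\<^sup>2 = 1"
  proof -
    have "norm x = 1" using False by (simp add: x_def norm_sgn)
    then show ?thesis using cmod_power2[of x] by simp
  qed
  have "(norm (shear t v))\<^sup>2 = (norm v)\<^sup>2 * ((Re x - t * Im x)\<^sup>2 + (Im x)\<^sup>2)"
    unfolding cmod_power2[of "shear t v"] by (simp add: shear_def v power2_eq_square algebra_simps)
  also have "(Re x - t * Im x)\<^sup>2 + (Im x)\<^sup>2 = 1 + (t\<^sup>2 * (Im x)\<^sup>2 - t * Im (x\<^sup>2))"
    using x by (simp add: power2_eq_square algebra_simps)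
  also have "\<dots> \<le> 1 + (t\<^sup>2 - t * Im (x\<^sup>2))"
  proof -
    have "(Im x)\<^sup>2 \<le> 1" using x by (smt (verit) zero_le_power2)
    then show ?thesis using mult_left_mono[of "(Im x)\<^sup>2" 1 "t\<^sup>2"] by simp
  qed
  also have "\<dots> \<le> exp (t\<^sup>2 - t * Im (x\<^sup>2))" by (rule exp_ge_add_one_self)
  finally show ?thesis by (simp add: x_def mult_left_mono)
qed (simp add: shear_def)

lemma norm_sgn_diff_le:
  fixes x y :: complex
  assumes "y \<noteq> 0"
  shows "norm (sgn x - sgn y) \<le> 2 * norm (x - y) / norm y"
proof (cases "x = 0")
  case True
  then show ?thesis using assms by (simp add: norm_sgn)
next
  case False
  have "of_real (norm y) * (sgn x - sgn y) = (x - y) + of_real (norm y - norm x) * sgn x"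
    using False assms by (simp add: sgn_eq field_simps)
  then have "norm y * norm (sgn x - sgn y) = norm ((x - y) + of_real (norm y - norm x) * sgn x)"
    by (metis norm_mult norm_of_real abs_norm_cancel)
  also have "\<dots> \<le> norm (x - y) + norm (x - y)"
  proof (rule norm_triangle_mono[OF order_refl])
    show "norm (of_real (norm y - norm x) * sgn x) \<le> norm (x - y)"
      using False norm_triangle_ineq3[of y x]
      by (simp add: norm_mult norm_sgn norm_minus_commute flip: of_real_diff)
  qed
  finally show ?thesis using assms by (simp add: field_simps)
qed

lemma norm_square_diff_le:
  fixes x y :: complex
  assumes "norm x \<le> 1" "norm y \<le> 1"
  shows "norm (x\<^sup>2 - y\<^sup>2) \<le> 2 * norm (x - y)"
proof -
  have "norm (x\<^sup>2 - y\<^sup>2) = norm (x - y) * norm (x + y)"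
    by (simp add: power2_eq_square square_diff_square_factored norm_mult mult.commute)
  also have "\<dots> \<le> norm (x - y) * 2"
    using norm_triangle_ineq[of x y] assms by (intro mult_left_mono) auto
  finally show ?thesis by simp
qed

text \<open>
  Shears of square-summable strength therefore keep the direction of an orbit so close to a uniform
  rotation that \<open>oscillating_sum_bound\<close> applies to it.
\<close>

lemma sgn_shear_le: "norm ((sgn (shear t v))\<^sup>2 - (sgn v)\<^sup>2) \<le> 4 * \<bar>t\<bar>"
proof (cases "v = 0")
  case False
  have "norm (sgn (shear t v) - sgn v) \<le> 2 * norm (shear t v - v) / norm v"
    by (rule norm_sgn_diff_le[OF False])
  also have "\<dots> = 2 * (\<bar>t\<bar> * \<bar>Im v\<bar>) / norm v"
    by (simp add: shear_def norm_mult abs_mult)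
  also have "\<dots> \<le> 2 * \<bar>t\<bar>"
    using False mult_left_mono[OF abs_Im_le_cmod[of v], of "2 * \<bar>t\<bar>"] by (simp add: field_simps)
  finally have *: "norm (sgn (shear t v) - sgn v) \<le> 2 * \<bar>t\<bar>" .
  have "norm ((sgn (shear t v))\<^sup>2 - (sgn v)\<^sup>2) \<le> 2 * norm (sgn (shear t v) - sgn v)"
    by (rule norm_square_diff_le) (simp_all add: norm_sgn)
  then show ?thesis using * by linarith
qed (simp add: shear_def)

section \<open>Feedback control of countably many rotations\<close>

text \<open>
  The error bounds below for sums started at index \<open>m\<close> are multiples of \<open>tail e m\<close>; the constant for
  the pair \<open>i\<close>, \<open>j\<close> is \<open>crosstalk \<theta> s i j\<close>, whose denominators measure how far the pair is from
  resonance.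
\<close>

definition tail :: "(nat \<Rightarrow> real) \<Rightarrow> nat \<Rightarrow> real" where
  "tail e m = 1 / real (Suc m) + (\<Sum>k. (e (k + m))\<^sup>2)"

definition crosstalk :: "(nat \<Rightarrow> real) \<Rightarrow> (nat \<Rightarrow> real) \<Rightarrow> nat \<Rightarrow> nat \<Rightarrow> real" where
  "crosstalk \<theta> s i j = (2 + 4 / \<bar>s i\<bar> + 4 / \<bar>s j\<bar>) *
     (1 / norm (cis (2 * (\<theta> i + \<theta> j)) - 1) + 1 / norm (cis (2 * (\<theta> i - \<theta> j)) - 1))"

text \<open>
  State \<open>j\<close> is rotated by \<open>\<theta> j\<close> in every step and then sheared with strength \<open>\<epsilon> / s j\<close>, where the
  single number \<open>\<epsilon>\<close> is common to all states.  State \<open>j\<close> takes part in the choice of \<open>\<epsilon>\<close> from time \<open>N j\<close>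
  on.  The assumption \<open>gain_le\<close> keeps \<open>\<epsilon>\<close> below the square-summable sequence \<open>e\<close>.
\<close>

locale feedback_control =
  fixes \<theta> s :: "nat \<Rightarrow> real" and N :: "nat \<Rightarrow> nat" and e :: "nat \<Rightarrow> real"
  assumes s_nz: "s j \<noteq> 0"
    and N_ge: "j \<le> N j"
    and e_ge: "1 / real (Suc k) \<le> e k"
    and e_summable: "summable (\<lambda>k. (e k)\<^sup>2)"
    and gain_le: "(\<Sum>j | N j \<le> k. 4 * \<bar>s j\<bar>) / real (Suc k) \<le> e k"
    and nonres_self: "cis (4 * \<theta> j) \<noteq> 1"
    and nonres_add: "i \<noteq> j \<Longrightarrow> cis (2 * (\<theta> i + \<theta> j)) \<noteq> 1"
    and nonres_diff: "i \<noteq> j \<Longrightarrow> cis (2 * (\<theta> i - \<theta> j)) \<noteq> 1"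
begin

text \<open>
  By \<open>norm_shear_le\<close>, strength \<open>\<epsilon> = s j Im (sgn (v j))\<^sup>2\<close> would contract state \<open>j\<close>; the feedback
  superposes these strengths for all active states.  The factor \<open>4 / (k + 1)\<close> makes the squared length of
  every state decay like the inverse square of time, because the mean of the squared sine is \<open>1 / 2\<close>.
\<close>

definition feedback :: "nat \<Rightarrow> (nat \<Rightarrow> complex) \<Rightarrow> real" where
  "feedback k v = (\<Sum>j | N j \<le> k. 4 * s j / real (Suc k) * Im ((sgn (v j))\<^sup>2))"

primrec state :: "nat \<Rightarrow> nat \<Rightarrow> complex" where
  "state 0 = (\<lambda>j. 1)"
| "state (Suc k) =
     (\<lambda>j. shear (feedback k (\<lambda>j. cis (\<theta> j) * state k j) / s j) (cis (\<theta> j) * state k j))"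

definition control :: "nat \<Rightarrow> real" where
  "control k = feedback k (\<lambda>j. cis (\<theta> j) * state k j)"

text \<open>
  Squared, because only the double argument enters the first-order change of length.
\<close>

definition direction :: "nat \<Rightarrow> nat \<Rightarrow> complex" where
  "direction j k = (sgn (cis (\<theta> j) * state k j))\<^sup>2"

lemma state_Suc: "state (Suc k) j = shear (control k / s j) (cis (\<theta> j) * state k j)"
  by (simp add: control_def)

lemma control_eq: "control k = (\<Sum>j | N j \<le> k. 4 * s j / real (Suc k) * Im (direction j k))"
  by (simp add: control_def direction_def feedback_def)

lemma state_nz: "state k j \<noteq> 0"
proof (induction k)
  case (Suc k)
  then show ?case by (simp only: state_Suc shear_eq_0_iff mult_eq_0_iff cis_neq_zero) simp
qed simp

lemma norm_direction [simp]: "norm (direction j k) = 1"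
  using state_nz by (simp add: direction_def norm_power norm_sgn)

lemma abs_control_le_gain: "\<bar>control k\<bar> \<le> (\<Sum>j | N j \<le> k. 4 * \<bar>s j\<bar>) / real (Suc k)"
  unfolding control_eq sum_divide_distrib
proof (rule order_trans[OF sum_abs sum_mono])
  fix j
  have "\<bar>Im (direction j k)\<bar> \<le> 1"
    using abs_Im_le_cmod[of "direction j k"] by simp
  then have "4 * \<bar>s j\<bar> / real (Suc k) * \<bar>Im (direction j k)\<bar> \<le> 4 * \<bar>s j\<bar> / real (Suc k)"
    by (intro mult_left_le) auto
  then show "\<bar>4 * s j / real (Suc k) * Im (direction j k)\<bar> \<le> 4 * \<bar>s j\<bar> / real (Suc k)"
    by (simp add: abs_mult)
qed

lemma abs_control_le: "\<bar>control k\<bar> \<le> e k"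
  using abs_control_le_gain gain_le by (rule order_trans)

lemma direction_Suc:
  "norm (direction j (Suc k) - cis (2 * \<theta> j) * direction j k) \<le> 4 / \<bar>s j\<bar> * e k"
proof -
  let ?v = "cis (\<theta> j) * state k j"
  have cis2: "cis (2 * \<theta> j) = (cis (\<theta> j))\<^sup>2" by (simp add: Complex.DeMoivre)
  have "direction j (Suc k) - cis (2 * \<theta> j) * direction j k
      = cis (2 * \<theta> j) * ((sgn (shear (control k / s j) ?v))\<^sup>2 - (sgn ?v)\<^sup>2)"
    by (simp only: direction_def state_Suc sgn_mult cis2 power_mult_distrib right_diff_distrib)
       (simp add: sgn_eq)
  then have "norm (direction j (Suc k) - cis (2 * \<theta> j) * direction j k)
      = norm ((sgn (shear (control k / s j) ?v))\<^sup>2 - (sgn ?v)\<^sup>2)"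
    by (simp add: norm_mult)
  also have "\<dots> \<le> 4 * \<bar>control k / s j\<bar>" by (rule sgn_shear_le)
  also have "\<dots> \<le> 4 / \<bar>s j\<bar> * e k"
    using mult_left_mono[OF abs_control_le[of k], of "4 / \<bar>s j\<bar>"] by simp
  finally show ?thesis .
qed

lemma direction_mult_Suc:
  fixes x y :: "nat \<Rightarrow> complex"
  assumes "\<And>k. norm (x k) = 1" "\<And>k. norm (y k) = 1"
    and "\<And>k. norm (x (Suc k) - \<alpha> * x k) \<le> A * e k"
    and "\<And>k. norm (y (Suc k) - \<beta> * y k) \<le> B * e k"
    and "norm \<alpha> = 1"
  shows "norm (x (Suc k) * y (Suc k) - (\<alpha> * \<beta>) * (x k * y k)) \<le> (A + B) * e k"
proof -
  have "x (Suc k) * y (Suc k) - (\<alpha> * \<beta>) * (x k * y k)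
      = (x (Suc k) - \<alpha> * x k) * y (Suc k) + (\<alpha> * x k) * (y (Suc k) - \<beta> * y k)"
    by (simp add: algebra_simps)
  also have "norm \<dots> \<le> A * e k + B * e k"
    by (rule norm_triangle_mono) (simp_all add: norm_mult assms)
  finally show ?thesis by (simp add: algebra_simps)
qed

lemma harmonic_decseq: "decseq (\<lambda>k. 1 / real (Suc k))"
  by (auto simp: decseq_def frac_le)

lemma tail_sum_nonneg: "0 \<le> (\<Sum>k. (e (k + m))\<^sup>2)"
  by (rule suminf_nonneg[OF summable_ignore_initial_segment[OF e_summable]]) simp

lemma weighted_sum_le:
  fixes Z :: "nat \<Rightarrow> complex"
  assumes "\<omega> \<noteq> 1" "\<And>k. norm (Z k) \<le> 1" "0 \<le> C"
    and "\<And>k. norm (Z (Suc k) - \<omega> * Z k) \<le> C * e k"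
  shows "norm (\<Sum>k=m..<n. of_real (1 / real (Suc k)) * Z k) \<le> (2 + C) * tail e m / norm (\<omega> - 1)"
proof -
  have "norm (\<Sum>k=m..<n. of_real (1 / real (Suc k)) * Z k)
      \<le> (2 * (1 / real (Suc m)) + C * (\<Sum>k. (e (k + m))\<^sup>2)) / norm (\<omega> - 1)"
    by (rule oscillating_sum_bound[where e = e])
       (use assms harmonic_decseq e_ge e_summable in auto)
  also have "2 * (1 / real (Suc m)) + C * (\<Sum>k. (e (k + m))\<^sup>2) \<le> (2 + C) * tail e m"
  proof -
    have "0 \<le> C * (1 / real (Suc m))" using \<open>0 \<le> C\<close> by simp
    then show ?thesis
      using tail_sum_nonneg[of m] unfolding tail_def distrib_left distrib_right by linarith
  qed
  finally show ?thesis by (simp add: divide_right_mono)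
qed

lemma weighted_Im_mult_Im:
  "c * (Im x * Im y) = (Re (of_real c * (x * cnj y)) - Re (of_real c * (x * y))) / 2"
  by (simp add: algebra_simps)

text \<open>
  Distinct states hardly influence each other: the product of the two sines is a combination of
  rotations by \<open>2 (\<theta> j + \<theta> i)\<close> and \<open>2 (\<theta> j - \<theta> i)\<close>, neither of which is a full turn.
\<close>

lemma cross_sum_le:
  assumes "i \<noteq> j"
  shows "\<bar>\<Sum>k=m..<n. 1 / real (Suc k) * (Im (direction j k) * Im (direction i k))\<bar>
    \<le> crosstalk \<theta> s i j * tail e m"
proof -
  let ?A = "4 / \<bar>s j\<bar> + 4 / \<bar>s i\<bar>"
  let ?p = "\<lambda>k. direction j k * direction i k" and ?q = "\<lambda>k. direction j k * cnj (direction i k)"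
  let ?S = "\<lambda>Z. \<Sum>k=m..<n. of_real (1 / real (Suc k)) * Z k"
  have cnj: "norm (cnj (direction i (Suc k)) - cis (- 2 * \<theta> i) * cnj (direction i k))
      \<le> 4 / \<bar>s i\<bar> * e k" for k
    using direction_Suc[of i k]
    by (metis cis_cnj complex_cnj_diff complex_cnj_mult complex_mod_cnj mult_minus_left)
  have add: "cis (2 * \<theta> j) * cis (2 * \<theta> i) = cis (2 * (\<theta> i + \<theta> j))"
    by (simp add: cis_mult algebra_simps)
  have diff: "cis (2 * \<theta> j) * cis (- 2 * \<theta> i) = cnj (cis (2 * (\<theta> i - \<theta> j)))"
    by (simp add: cis_mult cis_cnj algebra_simps)
  have p: "norm (?S ?p) \<le> (2 + ?A) * tail e m / norm (cis (2 * (\<theta> i + \<theta> j)) - 1)"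
  proof (rule weighted_sum_le)
    show "norm (?p (Suc k) - cis (2 * (\<theta> i + \<theta> j)) * ?p k) \<le> ?A * e k" for k
      unfolding add[symmetric] by (rule direction_mult_Suc[OF _ _ direction_Suc direction_Suc]) simp_all
  qed (use nonres_add[OF assms] in \<open>simp_all add: norm_mult\<close>)
  have q: "norm (?S ?q) \<le> (2 + ?A) * tail e m / norm (cnj (cis (2 * (\<theta> i - \<theta> j))) - 1)"
  proof (rule weighted_sum_le)
    show "norm (?q (Suc k) - cnj (cis (2 * (\<theta> i - \<theta> j))) * ?q k) \<le> ?A * e k" for k
      unfolding diff[symmetric] by (rule direction_mult_Suc[OF _ _ direction_Suc cnj]) simp_all
    show "cnj (cis (2 * (\<theta> i - \<theta> j))) \<noteq> 1"
      using nonres_diff[OF assms] by (metis complex_cnj_cnj complex_cnj_one)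
  qed (simp_all add: norm_mult)
  have nd: "norm (cnj (cis (2 * (\<theta> i - \<theta> j))) - 1) = norm (cis (2 * (\<theta> i - \<theta> j)) - 1)"
    by (metis complex_cnj_diff complex_cnj_one complex_mod_cnj)
  have eq: "(\<Sum>k=m..<n. 1 / real (Suc k) * (Im (direction j k) * Im (direction i k)))
      = (Re (?S ?q) - Re (?S ?p)) / 2"
    unfolding Re_sum sum_subtractf[symmetric] sum_divide_distrib
    by (rule sum.cong[OF refl weighted_Im_mult_Im])
  have *: "\<bar>(x - y) / 2\<bar> \<le> u + v" if "\<bar>x\<bar> \<le> u" "\<bar>y\<bar> \<le> v" for x y u v :: real
    using that by argo
  have "\<bar>\<Sum>k=m..<n. 1 / real (Suc k) * (Im (direction j k) * Im (direction i k))\<bar>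
      \<le> norm (?S ?q) + norm (?S ?p)"
    unfolding eq by (rule *[OF abs_Re_le_cmod abs_Re_le_cmod])
  also have "\<dots> \<le> (2 + ?A) * tail e m / norm (cis (2 * (\<theta> i - \<theta> j)) - 1)
      + (2 + ?A) * tail e m / norm (cis (2 * (\<theta> i + \<theta> j)) - 1)"
    using p q unfolding nd by (rule add_mono[rotated])
  also have "\<dots> = crosstalk \<theta> s i j * tail e m"
  proof -
    have *: "A * t / y + A * t / x = (A * (1 / x + 1 / y)) * t" for A t x y :: real
      by (simp add: distrib_left distrib_right)
    show ?thesis unfolding crosstalk_def * by (simp only: add.assoc add.commute add.left_commute)
  qed
  finally show ?thesis .
qed

text \<open>
  The squared sine is \<open>1 / 2\<close> minus an oscillation with rotation by \<open>4 \<theta> i\<close>, so that its weighted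
  sum is half a harmonic sum, up to a bounded error.  At \<open>\<theta> i = \<pi> / 2\<close> this rotation would
  be a full turn and the oscillation a constant.
\<close>

lemma self_sum_ge:
  "\<exists>C. \<forall>n. ln (real (Suc n)) / 2 - C \<le> (\<Sum>k=m..<n. 1 / real (Suc k) * (Im (direction i k))\<^sup>2)"
proof -
  let ?A = "4 / \<bar>s i\<bar> + 4 / \<bar>s i\<bar>"
  let ?p = "\<lambda>k. direction i k * direction i k"
  define H where "H = (\<Sum>k<m. 1 / real (Suc k))"
  define D where "D = (2 + ?A) * tail e m / norm (cis (4 * \<theta> i) - 1)"
  have add: "cis (2 * \<theta> i) * cis (2 * \<theta> i) = cis (4 * \<theta> i)"
    by (simp add: cis_mult algebra_simps)
  have p: "norm (\<Sum>k=m..<n. of_real (1 / real (Suc k)) * ?p k) \<le> D" for n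
    unfolding D_def
  proof (rule weighted_sum_le)
    show "norm (?p (Suc k) - cis (4 * \<theta> i) * ?p k) \<le> ?A * e k" for k
      unfolding add[symmetric] by (rule direction_mult_Suc[OF _ _ direction_Suc direction_Suc]) simp_all
  qed (use nonres_self in \<open>simp_all add: norm_mult\<close>)
  have "ln (real (Suc n)) / 2 - (H + D) / 2 \<le> (\<Sum>k=m..<n. 1 / real (Suc k) * (Im (direction i k))\<^sup>2)" for n
  proof -
    have sq: "(Im (direction i k))\<^sup>2 = (1 - Re (?p k)) / 2" for k
    proof -
      have "(Re (direction i k))\<^sup>2 + (Im (direction i k))\<^sup>2 = 1"
        using cmod_power2[of "direction i k"] by simp
      then show ?thesis by (simp add: power2_eq_square)
    qed
    have "(\<Sum>k=m..<n. 1 / real (Suc k) * (Im (direction i k))\<^sup>2)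
      = (\<Sum>k=m..<n. 1 / real (Suc k)) / 2 - Re (\<Sum>k=m..<n. of_real (1 / real (Suc k)) * ?p k) / 2"
      unfolding Re_sum sum_subtractf[symmetric] sum_divide_distrib sq
      by (rule sum.cong) (simp_all add: field_simps)
    moreover have "Re (\<Sum>k=m..<n. of_real (1 / real (Suc k)) * ?p k) \<le> D"
      using complex_Re_le_cmod p by (rule order_trans)
    moreover have "ln (real (Suc n)) \<le> H + (\<Sum>k=m..<n. 1 / real (Suc k))"
    proof -
      have "ln (real (Suc n)) \<le> (\<Sum>k<n. 1 / real (Suc k))"
        using ln_le_harm[of n] by (simp add: harm_def sum.atLeast1_atMost_eq inverse_eq_divide add.commute)
      also have "\<dots> \<le> (\<Sum>k\<in>{..<m} \<union> {m..<n}. 1 / real (Suc k))"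
        by (rule sum_mono2) auto
      also have "\<dots> = H + (\<Sum>k=m..<n. 1 / real (Suc k))"
        unfolding H_def by (rule sum.union_disjoint) auto
      finally show ?thesis .
    qed
    moreover have "L / 2 - (H + D) / 2 \<le> S" if "S = A / 2 - R / 2" "R \<le> D" "L \<le> H + A"
      for L S A R :: real
      using that by argo
    ultimately show ?thesis by blast
  qed
  then show ?thesis by blast
qed

lemma norm_state_le:
  "(norm (state n i))\<^sup>2 \<le> exp (\<Sum>k<n. (control k / s i)\<^sup>2 - control k / s i * Im (direction i k))"
proof (induction n)
  case (Suc n)
  have "(norm (state (Suc n) i))\<^sup>2 \<le> (norm (cis (\<theta> i) * state n i))\<^sup>2 *
      exp ((control n / s i)\<^sup>2 - control n / s i * Im (direction i n))"
    unfolding state_Suc direction_def by (rule norm_shear_le)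
  also have "\<dots> \<le> exp (\<Sum>k<n. (control k / s i)\<^sup>2 - control k / s i * Im (direction i k)) *
      exp ((control n / s i)\<^sup>2 - control n / s i * Im (direction i n))"
    using Suc.IH by (intro mult_right_mono) (simp_all add: norm_mult)
  finally show ?case by (simp flip: exp_add)
qed simp

text \<open>
  The assumption says that the total crosstalk reaching state \<open>i\<close> is finite.  Exchanging the sums
  over time and over states leaves the contribution of state \<open>i\<close> itself, which diverges
  logarithmically, and a bounded remainder.
\<close>

lemma control_sum_ge:
  assumes "summable (\<lambda>j. if j = i then 0 else 4 * \<bar>s j / s i\<bar> * (crosstalk \<theta> s i j * tail e (N j)))"
  shows "\<exists>C. \<forall>n. 2 * ln (real (Suc n)) - C \<le> (\<Sum>k<n. control k / s i * Im (direction i k))"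
proof -
  let ?X = "\<lambda>j n. \<Sum>k=N j..<n. 1 / real (Suc k) * (Im (direction j k) * Im (direction i k))"
  let ?y = "\<lambda>j. if j = i then 0 else 4 * \<bar>s j / s i\<bar> * (crosstalk \<theta> s i j * tail e (N j))"
  obtain C where C: "\<And>n. ln (real (Suc n)) / 2 - C \<le> ?X i n"
    using self_sum_ge[where m = "N i" and i = i] unfolding power2_eq_square by blast
  have y0: "0 \<le> ?y j" for j
  proof -
    have "0 \<le> crosstalk \<theta> s i j" "0 \<le> tail e (N j)"
      using tail_sum_nonneg by (auto simp: crosstalk_def tail_def)
    then show ?thesis by simp
  qed
  have "2 * ln (real (Suc n)) - (4 * C + suminf ?y) \<le> (\<Sum>k<n. control k / s i * Im (direction i k))"
    for n
  proof -
    \<comment> \<open>As \<open>j \<le> N j\<close>, only states below \<open>n\<close> have been active before time \<open>n\<close>.\<close>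
    define J where "J = insert i {..<n}"
    have "(\<Sum>k<n. control k / s i * Im (direction i k))
        = (\<Sum>k<n. \<Sum>j\<in>J. if N j \<le> k then
            4 * (s j / s i) * (1 / real (Suc k) * (Im (direction j k) * Im (direction i k))) else 0)"
    proof (rule sum.cong[OF refl])
      fix k assume "k \<in> {..<n}"
      have sub: "{j. N j \<le> k} \<subseteq> J"
      proof
        fix j assume "j \<in> {j. N j \<le> k}"
        then have "j < n" using N_ge[of j] \<open>k \<in> {..<n}\<close> by simp
        then show "j \<in> J" by (simp add: J_def)
      qed
      have "control k / s i * Im (direction i k) = (\<Sum>j | N j \<le> k.
            4 * (s j / s i) * (1 / real (Suc k) * (Im (direction j k) * Im (direction i k))))"
        unfolding control_eq sum_divide_distrib sum_distrib_right
        by (rule sum.cong) (simp_all add: field_simps)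
      also have "\<dots> = (\<Sum>j\<in>J. if N j \<le> k then
            4 * (s j / s i) * (1 / real (Suc k) * (Im (direction j k) * Im (direction i k))) else 0)"
        using sub by (intro sum.mono_neutral_cong_left) (auto simp: J_def)
      finally show "control k / s i * Im (direction i k) = \<dots>" .
    qed
    also have "\<dots> = (\<Sum>j\<in>J. 4 * (s j / s i) * ?X j n)"
    proof (subst sum.swap, rule sum.cong[OF refl])
      fix j
      show "(\<Sum>k<n. if N j \<le> k then
            4 * (s j / s i) * (1 / real (Suc k) * (Im (direction j k) * Im (direction i k))) else 0)
          = 4 * (s j / s i) * ?X j n"
        unfolding sum_distrib_left by (rule sum.mono_neutral_cong_right) auto
    qed
    also have "\<dots> = 4 * ?X i n + (\<Sum>j\<in>J - {i}. 4 * (s j / s i) * ?X j n)"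
      using s_nz[of i] by (subst sum.remove[of J i]) (auto simp: J_def)
    finally have eq: "(\<Sum>k<n. control k / s i * Im (direction i k)) = \<dots>" .
    have "\<bar>\<Sum>j\<in>J - {i}. 4 * (s j / s i) * ?X j n\<bar> \<le> (\<Sum>j\<in>J - {i}. ?y j)"
    proof (rule order_trans[OF sum_abs sum_mono])
      fix j assume "j \<in> J - {i}"
      then have ji: "i \<noteq> j" by auto
      have "4 * \<bar>s j / s i\<bar> * \<bar>?X j n\<bar> \<le> 4 * \<bar>s j / s i\<bar> * (crosstalk \<theta> s i j * tail e (N j))"
        by (intro mult_left_mono cross_sum_le[OF ji]) simp
      then show "\<bar>4 * (s j / s i) * ?X j n\<bar> \<le> ?y j"
        using ji by (simp add: abs_mult)
    qed
    also have "\<dots> \<le> suminf ?y"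
      using y0 by (intro sum_le_suminf assms) (auto simp: J_def)
    finally show ?thesis using eq C[of n] by linarith
  qed
  then show ?thesis by blast
qed

lemma state_decay:
  assumes "summable (\<lambda>j. if j = i then 0 else 4 * \<bar>s j / s i\<bar> * (crosstalk \<theta> s i j * tail e (N j)))"
  shows "\<exists>C. \<forall>n. norm (state n i) \<le> C / real (Suc n)"
proof -
  obtain C where C: "\<And>n. 2 * ln (real (Suc n)) - C \<le> (\<Sum>k<n. control k / s i * Im (direction i k))"
    using control_sum_ge[OF assms] by blast
  define E where "E = suminf (\<lambda>k. (e k)\<^sup>2) / (s i)\<^sup>2"
  have "norm (state n i) \<le> exp ((E + C) / 2) / real (Suc n)" for n
  proof (rule power2_le_imp_le)
    have "(\<Sum>k<n. (control k / s i)\<^sup>2) \<le> (\<Sum>k<n. (e k)\<^sup>2) / (s i)\<^sup>2"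
      unfolding sum_divide_distrib power_divide
    proof (intro sum_mono divide_right_mono)
      fix k
      show "(control k)\<^sup>2 \<le> (e k)\<^sup>2"
        using power_mono[OF abs_control_le abs_ge_zero, of k 2] by simp
    qed simp
    also have "\<dots> \<le> E"
      unfolding E_def by (intro divide_right_mono sum_le_suminf e_summable) auto
    finally have "(\<Sum>k<n. (control k / s i)\<^sup>2 - control k / s i * Im (direction i k))
        \<le> E + C - 2 * ln (real (Suc n))"
      using C[of n] by (simp add: sum_subtractf)
    then have "(norm (state n i))\<^sup>2 \<le> exp (E + C - 2 * ln (real (Suc n)))"
      using norm_state_le[of n i] by (meson exp_le_cancel_iff order_trans)
    also have "\<dots> = exp (E + C) / (real (Suc n))\<^sup>2"
      by (simp add: exp_diff exp_double)
    also have "\<dots> = (exp ((E + C) / 2) / real (Suc n))\<^sup>2"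
      by (simp add: power_divide flip: exp_double)
    finally show "(norm (state n i))\<^sup>2 \<le> (exp ((E + C) / 2) / real (Suc n))\<^sup>2" .
  qed simp
  then show ?thesis by blast
qed

end

lemma tail_tendsto_0:
  assumes "summable (\<lambda>k. (e k)\<^sup>2)"
  shows "tail e \<longlonglongrightarrow> 0"
proof -
  have "(\<lambda>m. \<Sum>k. (e (k + m))\<^sup>2) \<longlonglongrightarrow> 0"
    by (rule LIMSEQ_I) (use suminf_exist_split[OF _ assms] in auto)
  from tendsto_add[OF LIMSEQ_Suc[OF lim_1_over_n] this] show ?thesis
    by (simp add: tail_def[abs_def])
qed

text \<open>
  A single sequence \<open>\<epsilon>\<close>, only just larger than \<open>1 / k\<close>, makes all orbits decay.  The activation
  times are chosen one after the other: state \<open>j\<close> waits until \<open>\<kappa>\<close> has grown enough to pay for the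
  states up to \<open>j\<close>, and until the disturbance that it adds to each earlier state is at most
  \<open>2\<close> to the power \<open>- j\<close>.  What happens to a state before its activation affects only the constant
  in its own decay estimate.
\<close>

theorem decaying_control:
  fixes \<theta> s \<kappa> :: "nat \<Rightarrow> real"
  assumes s: "\<And>j. s j \<noteq> 0"
    and self: "\<And>j. cis (4 * \<theta> j) \<noteq> 1"
    and add: "\<And>i j. i \<noteq> j \<Longrightarrow> cis (2 * (\<theta> i + \<theta> j)) \<noteq> 1"
    and diff: "\<And>i j. i \<noteq> j \<Longrightarrow> cis (2 * (\<theta> i - \<theta> j)) \<noteq> 1"
    and \<kappa>0: "\<And>k. 0 \<le> \<kappa> k" and \<kappa>: "filterlim \<kappa> at_top sequentially"
  shows "\<exists>\<epsilon> w. (\<forall>k. \<bar>\<epsilon> k\<bar> \<le> \<kappa> k / real (Suc k)) \<and>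
    (\<forall>j. w j 0 = 1 \<and> (\<forall>k. w j (Suc k) = shear (\<epsilon> k / s j) (cis (\<theta> j) * w j k)) \<and>
         (\<exists>C. \<forall>k. norm (w j k) \<le> C / real (Suc k)))"
proof -
  \<comment> \<open>Any exponent strictly between \<open>- 1\<close> and \<open>- 1 / 2\<close> would do: the squares are summable, and
    the truncated budget \<open>B\<close> still tends to infinity.\<close>
  define e :: "nat \<Rightarrow> real" where "e k = real (Suc k) powr (- 3 / 4)" for k
  define B where "B k = min (\<kappa> k) (real (Suc k) powr (1 / 4))" for k
  define G where "G j = (\<Sum>i\<le>j. 4 * \<bar>s i\<bar>)" for j
  have e: "summable (\<lambda>k. (e k)\<^sup>2)"
  proof -
    have "summable (\<lambda>k. real (Suc k) powr (- 3 / 2))"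
      unfolding summable_Suc_iff[of "\<lambda>k. real k powr (- 3 / 2)"] summable_real_powr_iff by simp
    moreover have "(e k)\<^sup>2 = real (Suc k) powr (- 3 / 2)" for k
      unfolding e_def power2_eq_square powr_add[symmetric] by simp
    ultimately show ?thesis by presburger
  qed
  have e_ge: "1 / real (Suc k) \<le> e k" for k
    using powr_mono[of "- 1" "- 3 / 4" "real (Suc k)"] by (simp add: e_def powr_minus_divide)
  have B_le: "B k / real (Suc k) \<le> e k" "B k / real (Suc k) \<le> \<kappa> k / real (Suc k)" "0 \<le> B k" for k
  proof -
    have "real (Suc k) powr (1 / 4) / real (Suc k) = e k"
      unfolding e_def using powr_diff[of "real (Suc k)" "1 / 4" 1] by simp
    moreover have "B k / real (Suc k) \<le> real (Suc k) powr (1 / 4) / real (Suc k)"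
      by (rule divide_right_mono) (simp_all add: B_def)
    ultimately show "B k / real (Suc k) \<le> e k" by simp
    show "B k / real (Suc k) \<le> \<kappa> k / real (Suc k)"
      by (rule divide_right_mono) (simp_all add: B_def)
    show "0 \<le> B k" using \<kappa>0 by (simp add: B_def)
  qed
  have "filterlim (\<lambda>k. real (Suc k) powr (1 / 4)) at_top sequentially"
    by real_asymp
  then have B: "filterlim B at_top sequentially"
    unfolding B_def filterlim_at_top using \<kappa>[unfolded filterlim_at_top]
    by (auto intro: eventually_conj)
  have "\<exists>m. j \<le> m \<and> (\<forall>k\<ge>m. G j \<le> B k) \<and>
      (\<forall>i<j. 4 * \<bar>s j / s i\<bar> * (crosstalk \<theta> s i j * tail e m) \<le> (1 / 2) ^ j)" for j
  proof -
    have "\<forall>\<^sub>F m in sequentially. \<forall>k\<ge>m. G j \<le> B k"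
      using B[unfolded filterlim_at_top, rule_format, of "G j"]
      by (simp add: eventually_all_ge_at_top)
    moreover have "\<forall>\<^sub>F m in sequentially. \<forall>i\<in>{..<j}.
        4 * \<bar>s j / s i\<bar> * (crosstalk \<theta> s i j * tail e m) \<le> (1 / 2) ^ j"
    proof (rule eventually_ball_finite, simp, rule ballI)
      fix i
      have "(\<lambda>m. 4 * \<bar>s j / s i\<bar> * (crosstalk \<theta> s i j * tail e m)) \<longlonglongrightarrow> 0"
        by (intro tendsto_mult_right_zero tail_tendsto_0 e)
      from order_tendstoD(2)[OF this, of "(1 / 2) ^ j"]
      show "\<forall>\<^sub>F m in sequentially. 4 * \<bar>s j / s i\<bar> * (crosstalk \<theta> s i j * tail e m) \<le> (1 / 2) ^ j"
        by (auto elim: eventually_mono)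
    qed
    moreover have "\<forall>\<^sub>F m in sequentially. j \<le> m" by (rule eventually_ge_at_top)
    ultimately have "\<forall>\<^sub>F m in sequentially. j \<le> m \<and> (\<forall>k\<ge>m. G j \<le> B k) \<and>
        (\<forall>i\<in>{..<j}. 4 * \<bar>s j / s i\<bar> * (crosstalk \<theta> s i j * tail e m) \<le> (1 / 2) ^ j)"
      by (intro eventually_conj)
    from eventually_happens'[OF sequentially_bot this] show ?thesis by blast
  qed
  then have "\<exists>N. \<forall>j. j \<le> N j \<and> (\<forall>k\<ge>N j. G j \<le> B k) \<and>
      (\<forall>i<j. 4 * \<bar>s j / s i\<bar> * (crosstalk \<theta> s i j * tail e (N j)) \<le> (1 / 2) ^ j)"
    by (intro choice allI)
  then obtain N where N: "\<And>j. j \<le> N j" "\<And>j k. N j \<le> k \<Longrightarrow> G j \<le> B k"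
    "\<And>i j. i < j \<Longrightarrow> 4 * \<bar>s j / s i\<bar> * (crosstalk \<theta> s i j * tail e (N j)) \<le> (1 / 2) ^ j"
    by blast
  have gain: "(\<Sum>j | N j \<le> k. 4 * \<bar>s j\<bar>) \<le> B k" for k
  proof (cases "{j. N j \<le> k} = {}")
    case False
    have fin: "finite {j. N j \<le> k}"
      by (rule finite_subset[of _ "{..k}"]) (use N(1) in \<open>auto intro: order_trans\<close>)
    define M where "M = Max {j. N j \<le> k}"
    have "(\<Sum>j | N j \<le> k. 4 * \<bar>s j\<bar>) \<le> G M"
      unfolding G_def M_def using fin by (intro sum_mono2) auto
    also have "\<dots> \<le> B k" using Max_in[OF fin False] N(2) by (simp add: M_def)
    finally show ?thesis .
  qed (simp add: B_le)
  interpret feedback_control \<theta> s N e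
  proof
    show "(\<Sum>j | N j \<le> k. 4 * \<bar>s j\<bar>) / real (Suc k) \<le> e k" for k
      using divide_right_mono[OF gain, of "real (Suc k)" k] B_le(1)[of k] by simp
  qed (fact s N(1) e_ge e self add diff)+
  have "\<exists>C. \<forall>k. norm (state k i) \<le> C / real (Suc k)" for i
  proof (rule state_decay)
    show "summable (\<lambda>j. if j = i then 0 else 4 * \<bar>s j / s i\<bar> * (crosstalk \<theta> s i j * tail e (N j)))"
    proof (rule summable_comparison_test_ev)
      show "summable (\<lambda>j. (1 / 2 :: real) ^ j)" by (rule summable_geometric) simp
      have "0 \<le> crosstalk \<theta> s i j" "0 \<le> tail e (N j)" for j
        using tail_sum_nonneg by (auto simp: crosstalk_def tail_def)
      then show "\<forall>\<^sub>F j in sequentially.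
          norm (if j = i then 0 else 4 * \<bar>s j / s i\<bar> * (crosstalk \<theta> s i j * tail e (N j))) \<le> (1 / 2) ^ j"
        using N(3)[of i] by (intro eventually_mono[OF eventually_gt_at_top[of i]]) (auto simp: abs_mult)
    qed
  qed
  moreover have "\<bar>control k\<bar> \<le> \<kappa> k / real (Suc k)" for k
    using abs_control_le_gain[of k] divide_right_mono[OF gain, of "real (Suc k)" k] B_le(2)[of k]
    by simp
  ultimately show ?thesis
    using state_Suc by (intro exI[of _ control] exI[of _ "\<lambda>j k. state k j"]) simp
qed

section \<open>The monodromy matrix as a rotation\<close>

text \<open>
  The complex coordinate is the pairing with a left eigenvector \<open>(l, 1)\<close> of the monodromy matrix for
  the eigenvalue \<open>cis t\<close>.  The second entry can be normalised to 1 because the upper right matrix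
  entry is non-zero: otherwise the diagonal entries would have product 1, hence a sum of modulus at
  least 2.
\<close>

lemma monodromy_rotation:
  assumes J: "periodic_jacobi T a b" and x: "x \<in> sigma_ell T a b"
  defines "M \<equiv> monodromy T a b x" and "t \<equiv> quasi_momentum T a b x"
  obtains l :: complex where "Im l \<noteq> 0"
    and "\<And>y. l * of_real ((M *v y) $ 1) + of_real ((M *v y) $ 2)
            = cis t * (l * of_real (y $ 1) + of_real (y $ 2))"
proof -
  have t: "0 < t" "t < pi" "complex_eigenvalues M = {cis t, cis (- t)}"
    using quasi_momentum_eq_iff[OF J x, of t] by (simp_all add: t_def M_def)
  have det: "det M = 1" using det_monodromy[OF J] by (simp add: M_def)
  have "cis t \<in> complex_eigenvalues M" using t by simp
  then have char: "(cis t)\<^sup>2 - of_real (trace M) * cis t + 1 = 0"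
    by (simp add: complex_eigenvalues_2 det)
  have D: "M$1$1 * M$2$2 - M$1$2 * M$2$1 = 1" using det by (simp add: det_2)
  have tr: "trace M = M$1$1 + M$2$2" by (simp add: trace_def sum_2)
  have off: "M$1$2 \<noteq> 0"
  proof
    assume "M$1$2 = 0"
    then have "M$1$1 * M$2$2 = 1" using D by simp
    then have "(M$1$1 + M$2$2)\<^sup>2 = (M$1$1 - M$2$2)\<^sup>2 + 2\<^sup>2" by (simp add: power2_eq_square algebra_simps)
    then have "2\<^sup>2 \<le> \<bar>M$1$1 + M$2$2\<bar>\<^sup>2" by simp
    then have "2 \<le> \<bar>M$1$1 + M$2$2\<bar>" by (rule power2_le_imp_le) simp
    then show False using x by (simp add: sigma_ell_def tr flip: M_def)
  qed
  define l where "l = (cis t - of_real (M$2$2)) / of_real (M$1$2)"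
  have l2: "l * of_real (M$1$2) + of_real (M$2$2) = cis t" using off by (simp add: l_def)
  have "of_real (M$1$2) * (l * of_real (M$1$1) + of_real (M$2$1)) = of_real (M$1$2) * (cis t * l)"
  proof -
    have ml: "of_real (M$1$2) * l = cis t - of_real (M$2$2)" using l2 by (simp add: algebra_simps)
    have D': "complex_of_real (M$1$2) * of_real (M$2$1) = of_real (M$1$1) * of_real (M$2$2) - 1"
    proof -
      have "M$1$2 * M$2$1 = M$1$1 * M$2$2 - 1" using D by simp
      from arg_cong[OF this, of complex_of_real] show ?thesis by simp
    qed
    have "of_real (M$1$2) * (l * of_real (M$1$1) + of_real (M$2$1))
        = (of_real (M$1$2) * l) * of_real (M$1$1) + of_real (M$1$2) * of_real (M$2$1)"
      by (simp add: algebra_simps)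
    also have "\<dots> = cis t * of_real (M$1$1) - 1"
      unfolding ml D' by (simp add: algebra_simps)
    also have "\<dots> = (cis t)\<^sup>2 - of_real (M$2$2) * cis t"
      using char unfolding tr by (simp add: algebra_simps)
    also have "\<dots> = (of_real (M$1$2) * l) * cis t" unfolding ml by (simp add: power2_eq_square algebra_simps)
    finally show ?thesis by (simp only: mult_ac)
  qed
  then have l1: "l * of_real (M$1$1) + of_real (M$2$1) = cis t * l" using off by simp
  show ?thesis
  proof
    have "Im l = sin t / M$1$2" by (simp add: l_def)
    then show "Im l \<noteq> 0" using off t sin_gt_zero[of t] by simp
    fix y :: "real^2"
    have "l * of_real ((M *v y) $ 1) + of_real ((M *v y) $ 2)
        = (l * of_real (M$1$1) + of_real (M$2$1)) * of_real (y$1)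
          + (l * of_real (M$1$2) + of_real (M$2$2)) * of_real (y$2)"
      by (simp add: matrix_vector_mult_def sum_2 algebra_simps)
    then show "l * of_real ((M *v y) $ 1) + of_real ((M *v y) $ 2)
        = cis t * (l * of_real (y $ 1) + of_real (y $ 2))"
      unfolding l1 l2 by (simp add: algebra_simps)
  qed
qed

section \<open>Generalised eigenvectors of the perturbed operator\<close>

text \<open>
  The value 0 at index 0 encodes the boundary condition in the first row of the Jacobi matrix.
\<close>

fun eigvec :: "(nat \<Rightarrow> real) \<Rightarrow> (nat \<Rightarrow> real) \<Rightarrow> (nat \<Rightarrow> real) \<Rightarrow> real \<Rightarrow> nat \<Rightarrow> real" where
  "eigvec a b Q x 0 = 0"
| "eigvec a b Q x (Suc 0) = 1"
| "eigvec a b Q x (Suc (Suc m)) =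
     ((x - b (Suc m) - Q (Suc m)) * eigvec a b Q x (Suc m) - a m * eigvec a b Q x m) / a (Suc m)"

lemma eigvec_eigen:
  assumes "a m \<noteq> 0" "m \<ge> 1"
  shows "jacobi_op a b (eigvec a b Q x) m + diag_op Q (eigvec a b Q x) m = x * eigvec a b Q x m"
proof -
  obtain k where m: "m = Suc k" using \<open>m \<ge> 1\<close> by (cases m) auto
  have "a (Suc k) * eigvec a b Q x (Suc (Suc k)) =
      (x - b (Suc k) - Q (Suc k)) * eigvec a b Q x (Suc k) - a k * eigvec a b Q x k"
    using assms by (simp add: m)
  then show ?thesis
    by (cases k) (simp_all add: m jacobi_op_def diag_op_def numeral_2_eq_2 algebra_simps del: eigvec.simps(3))
qed

definition site_pair :: "(nat \<Rightarrow> real) \<Rightarrow> nat \<Rightarrow> real^2" where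
  "site_pair u m = vector [u m, u (Suc m)]"

lemma site_pair_nth [simp]: "site_pair u m $ 1 = u m" "site_pair u m $ 2 = u (Suc m)"
  by (simp_all add: site_pair_def)

lemma periodic_shift:
  assumes "periodic_jacobi T a b" "m \<ge> 1"
  shows "a (k * T + m) = a m" "b (k * T + m) = b m"
proof -
  have "a (k * T + m) = a m \<and> b (k * T + m) = b m"
  proof (induction k)
    case (Suc k)
    have "Suc k * T + m = (k * T + m) + T" by simp
    moreover have "k * T + m \<ge> 1" using assms(2) by simp
    ultimately show ?case using Suc.IH assms(1) unfolding periodic_jacobi_def by metis
  qed simp
  then show "a (k * T + m) = a m" "b (k * T + m) = b m" by auto
qed

text \<open>
  The transfer matrix of the unperturbed operator, corrected by the potential at the new site.  For
  \<open>k = r = 0\<close> the recursion reads \<open>a 0\<close> where the transfer matrix has \<open>a T\<close>; both are multiplied by the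
  value 0 of the vector at index 0.
\<close>

lemma eigvec_step:
  fixes Q :: "nat \<Rightarrow> real" and x :: real
  assumes J: "periodic_jacobi T a b" and "r < T"
  defines "u \<equiv> eigvec a b Q x"
  shows "site_pair u (k * T + Suc r) =
    transfer_matrix T a b (Suc r) x *v site_pair u (k * T + r)
    - vector [0, Q (k * T + Suc r) / a (Suc r) * u (k * T + Suc r)]"
proof -
  let ?m = "k * T + r"
  have per: "a (Suc ?m) = a (Suc r)" "b (Suc ?m) = b (Suc r)"
    using periodic_shift[OF J, of "Suc r" k] by simp_all
  have pos: "a (Suc r) > 0" using J by (simp add: periodic_jacobi_def)
  have prev: "a ?m * u ?m = (if Suc r = 1 then a T else a (Suc r - 1)) * u ?m"
  proof (cases "r = 0")
    case False
    then show ?thesis using periodic_shift(1)[OF J, of r k] by simp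
  next
    case True
    show ?thesis
    proof (cases k)
      case 0
      then show ?thesis using True by (simp add: u_def)
    next
      case (Suc k')
      have "T \<ge> 1" using J by (simp add: periodic_jacobi_def)
      then show ?thesis using True Suc periodic_shift(1)[OF J, of T k'] by (simp add: add.commute)
    qed
  qed
  have "u (Suc (Suc ?m)) = ((x - b (Suc r) - Q (Suc ?m)) * u (Suc ?m) - a ?m * u ?m) / a (Suc r)"
    by (simp add: u_def per)
  also have "\<dots> = - ((if Suc r = 1 then a T else a (Suc r - 1)) / a (Suc r)) * u ?m
      + (x - b (Suc r)) / a (Suc r) * u (Suc ?m) - Q (Suc ?m) / a (Suc r) * u (Suc ?m)"
    unfolding prev using pos by (simp add: field_simps)
  finally show ?thesis
    by (simp add: vec_eq_iff forall_2 transfer_matrix_def matrix_vector_mult_def sum_2)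
qed

lemma eigvec_block:
  assumes J: "periodic_jacobi T a b" and "r < T"
    and Q: "\<And>m. \<not> T dvd m \<Longrightarrow> Q m = 0"
  shows "site_pair (eigvec a b Q x) (k * T + r) =
    transfer_product T a b r x *v site_pair (eigvec a b Q x) (k * T)"
  using \<open>r < T\<close>
proof (induction r)
  case (Suc r)
  have "\<not> T dvd k * T + Suc r"
    using Suc.prems nat_dvd_not_less[of "Suc r" T] by (simp add: dvd_add_right_iff del: add_Suc_right)
  then have "Q (k * T + Suc r) = 0" by (rule Q)
  moreover have "vector [0, 0] = (0 :: real^2)" by (simp add: vec_eq_iff forall_2)
  ultimately show ?case
    using eigvec_step[OF J, where r = r and Q = Q and x = x and k = k] Suc by (simp add: matrix_vector_mul_assoc)
qed simp

lemma eigvec_period: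
  fixes Q :: "nat \<Rightarrow> real" and x :: real
  assumes J: "periodic_jacobi T a b"
    and Q: "\<And>m. \<not> T dvd m \<Longrightarrow> Q m = 0"
  defines "u \<equiv> eigvec a b Q x"
  shows "site_pair u (Suc k * T) = monodromy T a b x *v site_pair u (k * T)
    - vector [0, Q (Suc k * T) / a T * u (Suc k * T)]"
proof -
  obtain r where T: "T = Suc r" using J by (cases T) (auto simp: periodic_jacobi_def)
  have eq: "Suc k * T = k * T + Suc r" by (simp add: T)
  have "monodromy T a b x = transfer_matrix T a b (Suc r) x ** transfer_product T a b r x"
    by (simp add: monodromy_def T)
  moreover have "site_pair u (k * T + r) = transfer_product T a b r x *v site_pair u (k * T)"
    unfolding u_def by (rule eigvec_block[OF J _ Q]) (simp_all add: T)
  moreover have "r < T" "a T = a (Suc r)" by (simp_all add: T)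
  ultimately show ?thesis
    using eigvec_step[OF J, where r = r and Q = Q and x = x and k = k]
    unfolding u_def eq by (simp only: matrix_vector_mul_assoc)
qed

text \<open>
  The potential sits at the ends of the periods only.  There it changes the second component by a
  multiple of the first, and the first component is the imaginary part of the coordinate divided by
  \<open>Im l\<close>: this is a shear.
\<close>

lemma eigvec_eq_shear_orbit:
  fixes Q :: "nat \<Rightarrow> real" and x :: real
  assumes J: "periodic_jacobi T a b"
    and Q: "\<And>m. \<not> T dvd m \<Longrightarrow> Q m = 0" "\<And>k. Q (Suc k * T) = a T * \<epsilon> k"
    and "Im l \<noteq> 0"
    and l: "\<And>y. l * of_real ((monodromy T a b x *v y) $ 1) + of_real ((monodromy T a b x *v y) $ 2)
            = cis t * (l * of_real (y $ 1) + of_real (y $ 2))"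
    and w: "w 0 = 1" "\<And>k. w (Suc k) = shear (\<epsilon> k / Im l) (cis t * w k)"
  defines "u \<equiv> eigvec a b Q x"
  shows "l * of_real (u (k * T)) + of_real (u (Suc (k * T))) = w k"
proof (induction k)
  case 0
  then show ?case by (simp add: u_def w)
next
  case (Suc k)
  let ?y = "monodromy T a b x *v site_pair u (k * T)"
  have aT: "a T > 0" using J by (simp add: periodic_jacobi_def)
  have "site_pair u (Suc k * T) = ?y - vector [0, \<epsilon> k * u (Suc k * T)]"
    using eigvec_period[OF J Q(1), where x = x and k = k] aT by (simp add: u_def Q(2) del: mult_Suc)
  then have y: "u (Suc k * T) = ?y $ 1" "u (Suc (Suc k * T)) = ?y $ 2 - \<epsilon> k * u (Suc k * T)"
    by (simp_all add: vec_eq_iff forall_2 del: mult_Suc)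
  have v: "cis t * w k = l * of_real (?y $ 1) + of_real (?y $ 2)"
    using l[of "site_pair u (k * T)"] Suc.IH by simp
  then have "Im (cis t * w k) = Im l * ?y $ 1" by simp
  then have "w (Suc k) = cis t * w k - of_real (\<epsilon> k * ?y $ 1)"
    using \<open>Im l \<noteq> 0\<close> by (simp add: w shear_def)
  then show ?case unfolding v y by simp
qed

text \<open>
  The coordinate controls the vector at the ends of the periods, and inside a period there is no
  potential, so that finitely many fixed matrices control the remaining entries.
\<close>

lemma eigvec_in_l2:
  fixes Q :: "nat \<Rightarrow> real" and x :: real
  assumes J: "periodic_jacobi T a b"
    and Q: "\<And>m. \<not> T dvd m \<Longrightarrow> Q m = 0"
    and "Im l \<noteq> 0"
  defines "u \<equiv> eigvec a b Q x"
  assumes decay: "\<And>k. norm (l * of_real (u (k * T)) + of_real (u (Suc (k * T)))) \<le> C / real (Suc k)"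
  shows "u \<in> l2_seq"
proof -
  have T: "T \<ge> 1" using J by (simp add: periodic_jacobi_def)
  define A where "A = 1 / \<bar>Im l\<bar> + 1 + \<bar>Re l\<bar> / \<bar>Im l\<bar>"
  have pair: "norm (site_pair u (k * T)) \<le> A * (C / real (Suc k))" for k
  proof -
    define w where "w = l * of_real (u (k * T)) + of_real (u (Suc (k * T)))"
    have 1: "u (k * T) = Im w / Im l" using \<open>Im l \<noteq> 0\<close> by (simp add: w_def)
    then have "\<bar>u (k * T)\<bar> \<le> norm w / \<bar>Im l\<bar>"
      by (simp add: abs_Im_le_cmod divide_right_mono)
    moreover have "u (Suc (k * T)) = Re w - Re l * u (k * T)" by (simp add: w_def)
    then have "\<bar>u (Suc (k * T))\<bar> \<le> \<bar>Re w\<bar> + \<bar>Re l\<bar> * \<bar>u (k * T)\<bar>"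
      by (metis abs_mult abs_triangle_ineq4)
    then have "\<bar>u (Suc (k * T))\<bar> \<le> norm w + \<bar>Re l\<bar> * (norm w / \<bar>Im l\<bar>)"
      using abs_Re_le_cmod[of w] mult_left_mono[OF calculation, of "\<bar>Re l\<bar>"] by simp
    moreover have "norm (site_pair u (k * T)) \<le> \<bar>u (k * T)\<bar> + \<bar>u (Suc (k * T))\<bar>"
      using norm_le_l1_cart[of "site_pair u (k * T)"] by (simp add: sum_2)
    ultimately have "norm (site_pair u (k * T)) \<le> A * norm w"
      by (simp add: A_def algebra_simps)
    also have "\<dots> \<le> A * (C / real (Suc k))"
      using decay[of k] unfolding w_def by (intro mult_left_mono) (auto simp: A_def)
    finally show ?thesis .
  qed
  have "\<forall>r. \<exists>B\<ge>0. \<forall>y::real^2. norm (transfer_product T a b r x *v y) \<le> norm y * B"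
    using bounded_linear.nonneg_bounded[OF matrix_vector_mul_bounded_linear] by blast
  then obtain B where B: "\<And>r. 0 \<le> B r"
    "\<And>r (y::real^2). norm (transfer_product T a b r x *v y) \<le> norm y * B r" by metis
  define D where "D = A * C * (\<Sum>r<T. B r) * real T"
  have C0: "0 \<le> C"
    using decay[of 0] norm_ge_zero order_trans by (metis div_by_1 of_nat_1 One_nat_def)
  have A0: "0 \<le> A" by (simp add: A_def)
  have "norm (u m) \<le> D / real (Suc m)" for m
  proof -
    let ?k = "m div T" and ?r = "m mod T"
    have r: "?r < T" using T by simp
    have m: "m = ?k * T + ?r" by simp
    have "norm (u m) \<le> norm (site_pair u (?k * T + ?r))"
      using Finite_Cartesian_Product.norm_nth_le[of "site_pair u m" 1] by simp
    also have "\<dots> = norm (transfer_product T a b ?r x *v site_pair u (?k * T))"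
      using eigvec_block[OF J r Q, where x = x and k = ?k] by (simp add: u_def)
    also have "\<dots> \<le> norm (site_pair u (?k * T)) * B ?r" by (rule B)
    also have "\<dots> \<le> (A * (C / real (Suc ?k))) * (\<Sum>r<T. B r)"
      using r B(1) A0 C0 by (intro mult_mono pair member_le_sum) auto
    also have "\<dots> = A * C * (\<Sum>r<T. B r) / real (Suc ?k)" by simp
    also have "\<dots> \<le> D / real (Suc m)"
    proof -
      have "Suc m \<le> Suc ?k * T" using dividend_less_div_times[of T m] T by simp
      then have "real (Suc m) \<le> real (Suc ?k) * real T"
        by (metis of_nat_le_iff of_nat_mult)
      moreover have "0 \<le> A * C * (\<Sum>r<T. B r)"
        using A0 C0 B(1) by (simp add: sum_nonneg)
      ultimately have "(A * C * (\<Sum>r<T. B r)) * real (Suc m)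
          \<le> (A * C * (\<Sum>r<T. B r)) * (real (Suc ?k) * real T)"
        by (rule mult_left_mono)
      then show ?thesis
        unfolding D_def by (subst divide_le_eq, simp)  (simp add: field_simps)
    qed
    finally show ?thesis .
  qed
  then have *: "(u m)\<^sup>2 \<le> D\<^sup>2 / (real (Suc m))\<^sup>2" for m
    using power_mono[OF _ norm_ge_zero, of "u m" "D / real (Suc m)" 2] by (simp add: power_divide)
  have "summable (\<lambda>m. inverse ((real (m + 2))\<^sup>2))"
    by (rule summable_ignore_initial_segment[OF inverse_power_summable]) simp
  then have "summable (\<lambda>m. D\<^sup>2 * inverse ((real (Suc (Suc m)))\<^sup>2))"
    by (intro summable_mult) simp
  then have "summable (\<lambda>m. (u (Suc m))\<^sup>2)"
  proof (rule summable_comparison_test_ev[rotated], intro always_eventually allI)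
    show "norm ((u (Suc m))\<^sup>2) \<le> D\<^sup>2 * inverse ((real (Suc (Suc m)))\<^sup>2)" for m
      using *[of "Suc m"] by (simp add: divide_inverse)
  qed
  then show ?thesis by (simp add: l2_seq_def)
qed

section \<open>Nonresonance of the quasi-momenta\<close>

lemma cis_double_eq_1:
  assumes "cis (2 * x) = 1" "- pi < x" "x < 2 * pi"
  shows "x = 0 \<or> x = pi"
proof -
  have "sin x = 0"
  proof -
    have "cos (2 * x) = 1" using assms(1) by (simp add: complex_eq_iff)
    then show ?thesis by (simp add: cos_double_sin)
  qed
  then obtain i :: int where i: "x = of_int i * pi" by (auto simp: sin_zero_iff_int2)
  have "- 1 * pi < of_int i * pi" "of_int i * pi < 2 * pi" using assms i by simp_all
  then have "- 1 < i" "i < 2" by (simp_all only: mult_less_cancel_right_pos[OF pi_gt_zero])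
  then have "i = 0 \<or> i = 1" by linarith
  then show ?thesis using i by auto
qed

lemma coprime_fractions:
  fixes p q p' q' :: nat
  assumes "coprime p q" "coprime q q'" "q \<ge> 1" "q' \<ge> 1"
    and "real p / real q = real p' / real q' \<or> real p / real q + real p' / real q' = 1"
  shows "q = 1"
proof -
  have "q dvd p * q'"
    using assms(5)
  proof
    assume "real p / real q = real p' / real q'"
    then have "real (p * q') = real (p' * q)" using assms by (simp add: field_simps)
    then show ?thesis by (metis dvd_triv_right of_nat_eq_iff)
  next
    assume "real p / real q + real p' / real q' = 1"
    then have "real (p * q' + p' * q) = real (q * q')" using assms by (simp add: field_simps)
    then have "p * q' + p' * q = q * q'" by (simp only: of_nat_eq_iff)
    then show ?thesis by (metis dvd_add_left_iff dvd_triv_left dvd_triv_right)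
  qed
  then have "q dvd 1"
    using assms by (metis coprime_commute coprime_dvd_mult_right_iff coprime_common_divisor dvd_refl)
  then show ?thesis by simp
qed

text \<open>
  The cases \<open>y = z\<close> and \<open>r' = 0\<close> are included, so that this covers relations with one or two
  further members.
\<close>

lemma rationally_independent_no_relation:
  assumes "rationally_independent xs" "x \<in> set xs" "y \<in> set xs" "z \<in> set xs" "x \<noteq> y" "x \<noteq> z"
  shows "x \<noteq> of_rat r * y + of_rat r' * z"
proof
  assume x: "x = of_rat r * y + of_rat r' * z"
  interpret vector_space "\<lambda>r::rat. (*) (of_rat r :: real)"
    by unfold_locales (simp_all add: algebra_simps of_rat_add of_rat_mult)
  have "y \<in> span (set xs - {x})" "z \<in> span (set xs - {x})"
    using assms by (auto intro: span_base)
  then have "x \<in> span (set xs - {x})"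
    by (subst x) (intro span_add span_scale)
  then have "dependent (set xs)" using assms(2) by (auto simp: dependent_def)
  then show False using assms(1) by (simp add: rationally_independent_def)
qed

text \<open>
  Members of the independent part are linked to each other and to \<open>\<pi>\<close> by no rational relation;
  a rational multiple of \<open>\<pi>\<close> would be such a relation when it coincides with or complements one of
  them.  Two of the rational multiples that coincide or complement each other have denominators with a
  common factor.
\<close>

lemma nonresonant_angles:
  fixes \<phi> :: "nat \<Rightarrow> real" and p q :: "nat \<Rightarrow> nat" and n :: nat
  assumes range: "\<And>i. i \<ge> 1 \<Longrightarrow> 0 < \<phi> i" "\<And>i. i \<ge> 1 \<Longrightarrow> \<phi> i < pi"
    and indep: "\<forall>k\<ge>1. rationally_independent (pi # map (\<lambda>j. \<phi> (n + j)) [1..<Suc k])"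
    and frac: "\<forall>i\<in>{1..n}. p i \<ge> 1 \<and> q i \<ge> 1 \<and> gcd (p i) (q i) = 1 \<and>
           \<phi> i = real (p i) * pi / real (q i)"
    and coprime_q: "\<forall>i\<in>{1..n}. \<forall>j\<in>{1..n}. i \<noteq> j \<longrightarrow> gcd (q i) (q j) = 1"
    and not_half: "\<forall>i\<in>{1..n}. \<phi> i \<noteq> pi / 2"
  shows "\<And>i j. i \<ge> 1 \<Longrightarrow> j \<ge> 1 \<Longrightarrow> i \<noteq> j \<Longrightarrow> \<phi> i \<noteq> \<phi> j \<and> \<phi> i + \<phi> j \<noteq> pi"
    and "\<And>i. i \<ge> 1 \<Longrightarrow> \<phi> i \<noteq> pi / 2"
proof -
  have no_relation: "\<phi> i \<noteq> of_rat r * pi + of_rat r' * \<phi> j"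
    if "i > n" "j > n" "\<phi> i \<noteq> \<phi> j" for i j r r'
  proof -
    define k where "k = max i j - n"
    define xs where "xs = pi # map (\<lambda>j. \<phi> (n + j)) [1..<Suc k]"
    have "k \<ge> 1" using that by (simp add: k_def)
    then have xs: "rationally_independent xs"
      using indep unfolding xs_def by blast
    have mem: "\<phi> m \<in> set xs" if "n < m" "m \<le> max i j" for m
    proof -
      have "m - n \<in> set [1..<Suc k]" "\<phi> m = \<phi> (n + (m - n))" using that by (auto simp: k_def)
      then show ?thesis unfolding xs_def by auto
    qed
    show ?thesis
      by (rule rationally_independent_no_relation[OF xs])
         (use that mem[of i] mem[of j] range[of i] in \<open>auto simp: xs_def\<close>)
  qed
  have inj: "\<phi> i \<noteq> \<phi> j" if "i > n" "j > n" "i \<noteq> j" for i j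
  proof
    assume eq: "\<phi> i = \<phi> j"
    define k where "k = max i j - n"
    have "k \<ge> 1" using that by (simp add: k_def)
    then have "distinct (pi # map (\<lambda>j. \<phi> (n + j)) [1..<Suc k])"
      using indep unfolding rationally_independent_def by blast
    then have "inj_on (\<lambda>j. \<phi> (n + j)) (set [1..<Suc k])" by (simp add: distinct_map)
    then have "i - n = j - n"
      by (rule inj_onD) (use that eq in \<open>auto simp: k_def\<close>)
    then show False using that by simp
  qed
  have irrational: "\<phi> i \<noteq> of_rat r * pi" if "i > n" for i r
  proof -
    have "\<phi> i \<noteq> \<phi> (Suc i)" using that by (intro inj) auto
    then show ?thesis using no_relation[of i "Suc i" r 0] that by simp
  qed
  have mixed: "\<phi> i \<noteq> \<phi> j \<and> \<phi> i + \<phi> j \<noteq> pi" if "i > n" "j \<in> {1..n}" for i j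
  proof -
    define r :: rat where "r = of_nat (p j) / of_nat (q j)"
    have \<phi>j: "\<phi> j = of_rat r * pi"
      using frac that by (auto simp: r_def of_rat_divide)
    have "of_rat (1 - r) * pi = pi - \<phi> j"
      by (simp add: \<phi>j of_rat_diff algebra_simps)
    then show ?thesis
      using irrational[OF that(1), of r] irrational[OF that(1), of "1 - r"] \<phi>j by auto
  qed
  have pair: "\<phi> i \<noteq> \<phi> j \<and> \<phi> i + \<phi> j \<noteq> pi" if "i \<ge> 1" "j \<ge> 1" "i \<noteq> j" for i j
  proof (cases "i \<le> n"; cases "j \<le> n")
    assume "i \<le> n" "j \<le> n"
    then have i: "i \<in> {1..n}" and j: "j \<in> {1..n}" using that by auto
    have fi: "p i \<ge> 1" "q i \<ge> 1" "coprime (p i) (q i)" "\<phi> i = real (p i) / real (q i) * pi"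
      and fj: "q j \<ge> 1" "\<phi> j = real (p j) / real (q j) * pi"
      using frac i j by (auto simp: coprime_iff_gcd_eq_1)
    have "q i \<noteq> 1" using range[of i] that fi by auto
    moreover have "coprime (q i) (q j)" using coprime_q i j that by (auto simp: coprime_iff_gcd_eq_1)
    ultimately have "\<not> (real (p i) / real (q i) = real (p j) / real (q j)
        \<or> real (p i) / real (q i) + real (p j) / real (q j) = 1)"
      using coprime_fractions[OF fi(3) _ fi(2) fj(1)] by blast
    moreover have "x * pi = y * pi \<longleftrightarrow> x = y" "x * pi + y * pi = pi \<longleftrightarrow> x + y = 1" for x y :: real
      by (simp_all flip: distrib_right)
    ultimately show ?thesis unfolding fi(4) fj(2) by blast
  next
    assume "i \<le> n" "\<not> j \<le> n"
    then show ?thesis using mixed[of j i] that by (auto simp: add.commute)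
  next
    assume "\<not> i \<le> n" "j \<le> n"
    then show ?thesis using mixed[of i j] that by auto
  next
    assume "\<not> i \<le> n" "\<not> j \<le> n"
    then have ij: "i > n" "j > n" by auto
    have "\<phi> i \<noteq> of_rat 1 * pi + of_rat (- 1) * \<phi> j"
      using no_relation[OF ij inj[OF ij that(3)]] .
    then show ?thesis using inj[OF ij that(3)] by auto
  qed
  have half: "\<phi> i \<noteq> pi / 2" if "i \<ge> 1" for i
  proof (cases "i \<le> n")
    case True
    then show ?thesis using not_half that by simp
  next
    case False
    then show ?thesis using irrational[of i "1 / 2"] by (simp add: of_rat_divide)
  qed
  show "\<phi> i \<noteq> \<phi> j \<and> \<phi> i + \<phi> j \<noteq> pi" if "i \<ge> 1" "j \<ge> 1" "i \<noteq> j" for i j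
    using that by (rule pair)
  show "\<phi> i \<noteq> pi / 2" if "i \<ge> 1" for i
    using that by (rule half)
qed

section \<open>Embedded eigenvalues\<close>

text \<open>
  Equal quasi-momenta \<open>\<phi> i\<close>, \<open>\<phi> j\<close> and those with sum \<open>\<pi>\<close> are the two ways in which a pair can
  resonate: the double arguments of the two solutions then turn at the same rate, in the same or in
  opposite directions.  At \<open>\<pi> / 2\<close> a solution resonates with itself.
\<close>

theorem embedded_eigenvalues_of_nonresonant:
  fixes T :: nat and a b lam K :: "nat \<Rightarrow> real"
  defines "\<phi> \<equiv> \<lambda>i. quasi_momentum T a b (lam i)"
  assumes J: "periodic_jacobi T a b"
    and ell: "\<And>i. i \<ge> 1 \<Longrightarrow> lam i \<in> sigma_ell T a b"
    and pair: "\<And>i j. i \<ge> 1 \<Longrightarrow> j \<ge> 1 \<Longrightarrow> i \<noteq> j \<Longrightarrow> \<phi> i \<noteq> \<phi> j \<and> \<phi> i + \<phi> j \<noteq> pi"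
    and half: "\<And>i. i \<ge> 1 \<Longrightarrow> \<phi> i \<noteq> pi / 2"
    and K_pos: "\<forall>m\<ge>1. K m > 0"
    and K_lim: "filterlim K at_top sequentially"
  shows "\<exists>Q :: nat \<Rightarrow> real.
           (\<forall>m\<ge>1. \<bar>Q m\<bar> \<le> K m / real m) \<and>
           (\<forall>i\<ge>1. \<exists>u\<in>l2_seq. (\<exists>m\<ge>1. u m \<noteq> 0) \<and>
              (\<forall>m\<ge>1. jacobi_op a b u m + diag_op Q u m = lam i * u m))"
proof -
  have range: "0 < \<phi> i" "\<phi> i < pi" if "i \<ge> 1" for i
    using quasi_momentum_eq_iff[OF J ell[OF that], of "\<phi> i"] by (simp_all add: \<phi>_def)
  have "\<forall>j. \<exists>l. Im l \<noteq> 0 \<and> (\<forall>y. l * of_real ((monodromy T a b (lam (Suc j)) *v y) $ 1)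
      + of_real ((monodromy T a b (lam (Suc j)) *v y) $ 2)
      = cis (\<phi> (Suc j)) * (l * of_real (y $ 1) + of_real (y $ 2)))"
    using monodromy_rotation[OF J ell] unfolding \<phi>_def by (metis le_add1 plus_1_eq_Suc)
  then obtain l where l: "\<And>j. Im (l j) \<noteq> 0"
    "\<And>j y. l j * of_real ((monodromy T a b (lam (Suc j)) *v y) $ 1)
      + of_real ((monodromy T a b (lam (Suc j)) *v y) $ 2)
      = cis (\<phi> (Suc j)) * (l j * of_real (y $ 1) + of_real (y $ 2))"
    by metis
  have T: "T \<ge> 1" and aT: "a T > 0" using J by (auto simp: periodic_jacobi_def)
  \<comment> \<open>Time \<open>k\<close> corresponds to site \<open>(k + 1) T\<close>, where the potential is \<open>a T\<close> times the control.\<close>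
  define \<kappa> where "\<kappa> k = K (Suc k * T) / (real T * a T)" for k
  have "\<exists>\<epsilon> w. (\<forall>k. \<bar>\<epsilon> k\<bar> \<le> \<kappa> k / real (Suc k)) \<and>
    (\<forall>j. w j 0 = 1 \<and> (\<forall>k. w j (Suc k) = shear (\<epsilon> k / Im (l j)) (cis (\<phi> (Suc j)) * w j k)) \<and>
         (\<exists>C. \<forall>k. norm (w j k) \<le> C / real (Suc k)))"
  proof (rule decaying_control)
    show "Im (l j) \<noteq> 0" for j by (rule l)
    show "cis (4 * \<phi> (Suc j)) \<noteq> 1" for j
      using cis_double_eq_1[of "2 * \<phi> (Suc j)"] range[of "Suc j"] half[of "Suc j"] by auto
    show "cis (2 * (\<phi> (Suc i) + \<phi> (Suc j))) \<noteq> 1" if "i \<noteq> j" for i j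
      using cis_double_eq_1[of "\<phi> (Suc i) + \<phi> (Suc j)"] range[of "Suc i"] range[of "Suc j"]
        pair[of "Suc i" "Suc j"] that by auto
    show "cis (2 * (\<phi> (Suc i) - \<phi> (Suc j))) \<noteq> 1" if "i \<noteq> j" for i j
      using cis_double_eq_1[of "\<phi> (Suc i) - \<phi> (Suc j)"] range[of "Suc i"] range[of "Suc j"]
        pair[of "Suc i" "Suc j"] that by auto
    show "0 \<le> \<kappa> k" for k
      using K_pos[rule_format, of "Suc k * T"] T aT by (simp add: \<kappa>_def)
    have "filterlim (\<lambda>k. Suc k * T) at_top sequentially"
      by (rule filterlim_at_top_mono[OF filterlim_Suc always_eventually]) (use T in \<open>auto simp del: mult_Suc\<close>)
    from filterlim_compose[OF K_lim this]
    show "filterlim \<kappa> at_top sequentially"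
      unfolding \<kappa>_def divide_inverse
      by (rule filterlim_at_top_mult_tendsto_pos[OF tendsto_const, rotated]) (use T aT in auto)
  qed
  then obtain \<epsilon> w C where \<epsilon>: "\<And>k. \<bar>\<epsilon> k\<bar> \<le> \<kappa> k / real (Suc k)"
    and w: "\<And>j. w j 0 = 1" "\<And>j k. w j (Suc k) = shear (\<epsilon> k / Im (l j)) (cis (\<phi> (Suc j)) * w j k)"
      "\<And>j k. norm (w j k) \<le> C j / real (Suc k)"
    by metis
  define Q where "Q m = (if T dvd m then a T * \<epsilon> (m div T - 1) else 0)" for m
  have Q0: "Q m = 0" if "\<not> T dvd m" for m using that by (simp add: Q_def)
  have Q1: "Q (Suc k * T) = a T * \<epsilon> k" for k
    unfolding Q_def using T by (subst nonzero_mult_div_cancel_right) auto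
  show ?thesis
  proof (intro exI[of _ Q] conjI allI impI)
    fix m :: nat assume "m \<ge> 1"
    show "\<bar>Q m\<bar> \<le> K m / real m"
    proof (cases "T dvd m")
      case False
      then show ?thesis using Q0 K_pos \<open>m \<ge> 1\<close> by (simp add: less_imp_le)
    next
      case True
      then obtain k where m: "m = Suc k * T"
        using \<open>m \<ge> 1\<close> by (metis dvd_def mult.commute mult_0_right not0_implies_Suc not_one_le_zero)
      have "\<bar>Q m\<bar> = a T * \<bar>\<epsilon> k\<bar>" using aT by (simp add: m Q1 abs_mult del: mult_Suc)
      also have "\<dots> \<le> a T * (\<kappa> k / real (Suc k))" using aT \<epsilon> by (intro mult_left_mono) auto
      also have "\<dots> = K m / (real (Suc k) * real T)"
        using aT by (simp add: \<kappa>_def m mult.commute del: mult_Suc of_nat_Suc)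
      also have "real (Suc k) * real T = real m" unfolding m of_nat_mult ..
      finally show ?thesis .
    qed
  next
    fix i :: nat assume "i \<ge> 1"
    then obtain j where i: "i = Suc j" by (cases i) auto
    let ?u = "eigvec a b Q (lam i)"
    have "?u \<in> l2_seq"
    proof (rule eigvec_in_l2[OF J Q0 l(1)[of j]])
      have "l j * of_real (?u (k * T)) + of_real (?u (Suc (k * T))) = w j k" for k
        unfolding i by (rule eigvec_eq_shear_orbit[where \<epsilon> = \<epsilon>]) (fact J Q0 Q1 l w)+
      then show "norm (l j * of_real (?u (k * T)) + of_real (?u (Suc (k * T)))) \<le> C j / real (Suc k)" for k
        using w(3) by simp
    qed
    moreover have "?u 1 \<noteq> 0" by simp
    moreover have "\<forall>m\<ge>1. jacobi_op a b ?u m + diag_op Q ?u m = lam i * ?u m"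
    proof (intro allI impI)
      fix m :: nat assume "m \<ge> 1"
      then have "a m \<noteq> 0" using J by (metis less_numeral_extra(3) periodic_jacobi_def)
      then show "jacobi_op a b ?u m + diag_op Q ?u m = lam i * ?u m"
        using \<open>m \<ge> 1\<close> by (rule eigvec_eigen)
    qed
    ultimately show "\<exists>u\<in>l2_seq. (\<exists>m\<ge>1. u m \<noteq> 0) \<and>
              (\<forall>m\<ge>1. jacobi_op a b u m + diag_op Q u m = lam i * u m)"
      by (intro bexI[of _ ?u] conjI exI[of _ 1]) auto
  qed
qed

theorem theorem5p4:
  fixes T n :: nat and a b lam :: "nat \<Rightarrow> real" and p q :: "nat \<Rightarrow> nat" and K :: "nat \<Rightarrow> real"
  assumes "periodic_jacobi T a b"
    and "n \<ge> 1"
    and "\<forall>i>n. lam i \<in> sigma_ell T a b"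
    and "\<forall>k\<ge>1. rationally_independent
           (pi # map (\<lambda>j. quasi_momentum T a b (lam (n + j))) [1..<Suc k])"
    and "\<forall>i\<in>{1..n}. lam i \<in> sigma_ell T a b"
    and "\<forall>i\<in>{1..n}. p i \<ge> 1 \<and> q i \<ge> 1 \<and> gcd (p i) (q i) = 1 \<and>
           quasi_momentum T a b (lam i) = real (p i) * pi / real (q i)"
    and "\<forall>i\<in>{1..n}. \<forall>j\<in>{1..n}. i \<noteq> j \<longrightarrow> gcd (q i) (q j) = 1"
    and "\<forall>i\<in>{1..n}. quasi_momentum T a b (lam i) \<noteq> pi / 2"
    and "\<forall>m\<ge>1. K m > 0"
    and "filterlim K at_top sequentially"
  shows "\<exists>Q :: nat \<Rightarrow> real.
           (\<forall>m\<ge>1. \<bar>Q m\<bar> \<le> K m / real m) \<and>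
           (\<forall>i\<ge>1. \<exists>u\<in>l2_seq. (\<exists>m\<ge>1. u m \<noteq> 0) \<and>
              (\<forall>m\<ge>1. jacobi_op a b u m + diag_op Q u m = lam i * u m))"
proof -
  let ?\<phi> = "\<lambda>i. quasi_momentum T a b (lam i)"
  have ell: "lam i \<in> sigma_ell T a b" if "i \<ge> 1" for i
    using assms(3,5) that by (cases "i \<le> n") auto
  have range: "0 < ?\<phi> i" "?\<phi> i < pi" if "i \<ge> 1" for i
    using quasi_momentum_eq_iff[OF assms(1) ell[OF that], of "?\<phi> i"] by simp_all
  show ?thesis
    by (rule embedded_eigenvalues_of_nonresonant[OF assms(1) ell
          nonresonant_angles[OF range assms(4,6-8)] assms(9,10)])
qed

end
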